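(* Let $\lambda,\mu\in\mathbb{C}$, let $\theta_g,\theta_f\in[0,1]$, and assume $M=\Delta T/\Delta t=2$. Let $a,b,A,B$ be the coefficients of the fine and coarse stochastic $\theta$-methods for the equation $du(t)=\lambda u(t)\,dt+\mu u(t)\,dW(t)$, $u(0)=u_0\neq 0$, $t\in[0,T]$, given explicitly in the context, and assume that $$\mathrm{Im}\left(A\,\overline{a}^2+\sqrt{2}\,B\,\overline{ab}\right)=0 .$$ Let $\{u_n\}$ be the sequence generated serially by the fine propagator, and let $\{U_n^k\}$ and $\{\alpha_n^k\}$ be generated by the SParareal scheme described in the context, where $\alpha_n^k$ is defined by sampling rule 1 or by sampling rule 3 (described in the context). Define $\epsilon_n^k=\mathbb{E}\left[|U_n^k-u_n|^2\right]$ and $\widehat{\epsilon}^{(k)}=\sup_n \epsilon_n^k$. Set $$\gamma=|A|^2+|B|^2,\qquad \kappa=(|a|^2+|b|^2)^2,$$ $$\alpha=|A|^2+|B|^2+\left|A\overline{a}^2-|B|^2-|A|^2+\sqrt{2}B\,\overline{ab}\right|,$$ $$\beta=-2\,\mathrm{Re}(\overline{A}a^2)+|A|^2+|B|^2-2\sqrt{2}\,\mathrm{Re}(\overline{B}ab)+(|a|^2+|b|^2)^2+\left|A\overline{a}^2-|B|^2-|A|^2+\sqrt{2}B\,\overline{ab}\right|.$$ If $\alpha<1$, then for every iteration index $k\ge 0$ $$\widehat{\epsilon}^{(k)}\le \widehat{\epsilon}^{(0)}\left[\frac{\frac{4\beta\gamma}{1-\alpha}+\sqrt{\left(\frac{4\beta\gamma}{1-\alpha}\right)^2+4\,\frac{2\beta\kappa+4\beta\gamma}{1-\alpha}}}{2}\right]^k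 .$$
   Context: Time grid: $[0,T]$ is divided into $N$ subintervals $[T_n,T_{n+1}]$, $T_n=n\Delta T$, $n=0,\dots,N-1$, with $\Delta T=T/N$. The coarse propagator takes one step of size $\Delta T$ on each subinterval, and the fine propagator takes $M=2$ steps of size $\Delta t=\Delta T/2$. $W$ is a standard (real) Wiener process. The supremum $\sup_n$ is over $n=0,\dots,N$. Noise: for $n=0,\dots,N-1$ and $j=0,1$, $$\sqrt{\Delta t}\,\upsilon_{n+\frac{j}{2}}=W(n\Delta T+(j+1)\Delta t)-W(n\Delta T+j\Delta t),\qquad \sqrt{\Delta T}\,V_n=W((n+1)\Delta T)-W(n\Delta T),$$ so the $\upsilon_{n+\frac{j}{2}}$ are independent $\mathcal{N}(0,1)$ variables and $V_n=\frac{1}{\sqrt2}(\upsilon_n+\upsilon_{n+\frac12})$. Coefficients (stochastic $\theta$-method with parameter $\theta_f$ for the fine propagator and $\theta_g$ for the coarse propagator; the denominators are assumed nonzero): $$a=\frac{1+(1-\theta_f)\Delta t\,\lambda}{1-\theta_f\Delta t\,\lambda},\quad b=\frac{\sqrt{\Delta t}\,\mu}{1-\theta_f\Delta t\,\lambda},\quad A=\frac{1+(1-\theta_g)\Delta T\,\lambda}{1-\theta_g\Delta T\,\lambda},\quad B=\frac{\sqrt{\Delta T}\,\mu}{1-\theta_g\Delta T\,\lambda}.$$ Propagators over $[T_n,T_{n+1}]$ applied to a value $U$ at time $T_n$: $$\mathcal{F}_{\Delta t}(U)=(a+b\upsilon_{n+\frac12})(a+b\upsilon_n)\,U,\qquad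 \mathcal{G}_{\Delta T}(U)=(A+BV_n)\,U.$$ The serial fine solution is $u_{n+1}=\mathcal{F}_{\Delta t}(u_n)$ for $n=0,\dots,N-1$, with initial value $u_0$. SParareal scheme: $U_0^k=u_0$ for all $k\ge0$; $U_{n+1}^0=\mathcal{G}_{\Delta T}(U_n^0)$; and for $k\ge 0$, $0\le n\le N-1$, $$U_{n+1}^{k+1}=(A+BV_n)U_n^{k+1}+\left[(a+b\upsilon_{n+\frac12})(a+b\upsilon_n)-(A+BV_n)\right]\alpha_n^k .$$ The first iteration is the classical Parareal one, i.e. $\alpha_n^0=U_n^0$, and at the initial time $\alpha_0^k=u_0$. For $k\ge1$, $n\ge1$, put $$\sigma_n^k=\left|\mathcal{G}_{\Delta T}(U_{n-1}^k)-\mathcal{G}_{\Delta T}(U_{n-1}^{k-1})\right|=\left|(A+BV_{n-1})(U_{n-1}^k-U_{n-1}^{k-1})\right| ,$$ and note that $\mathcal{F}_{\Delta t}(U_{n-1}^{k-1})=(a+b\upsilon_{n-\frac12})(a+b\upsilon_{n-1})U_{n-1}^{k-1}$. Sampling rule 1: $\alpha_n^k=\mathcal{F}_{\Delta t}(U_{n-1}^{k-1})+\sigma_n^k z_n^k$, where $z_n^k\sim\mathcal{N}(0,1)$. Sampling rule 3: $\alpha_n^k=\mathcal{F}_{\Delta t}(U_{n-1}^{k-1})+\sqrt3\,\sigma_n^k(2\omega_n^k-1)$, where $\omega_n^k$ is uniform on $[0,1]$. The variables $z_n^k$ (resp. $\omega_n^k$) are mutually independent and independent of $W$. *)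

theory Defs
  imports "HOL-Probability.Probability"
begin

text \<open>The process is only required on \<open>[0, T]\<close>; continuity of paths holds almost surely.\<close>

definition wiener_process :: "'w measure \<Rightarrow> real \<Rightarrow> (real \<Rightarrow> 'w \<Rightarrow> real) \<Rightarrow> bool" where
  "wiener_process M T W \<longleftrightarrow>
     (\<forall>t\<in>{0..T}. W t \<in> borel_measurable M) \<and>
     (AE \<omega> in M. W 0 \<omega> = 0) \<and>
     (AE \<omega> in M. continuous_on {0..T} (\<lambda>t. W t \<omega>)) \<and>
     (\<forall>s t. 0 \<le> s \<and> s < t \<and> t \<le> T \<longrightarrow>
        distributed M lborel (\<lambda>\<omega>. W t \<omega> - W s \<omega>) (normal_density 0 (sqrt (t - s)))) \<and>
     (\<forall>(m::nat) \<tau>. (\<forall>i\<le>m. \<tau> i \<in> {0..T}) \<and> (\<forall>i<m. \<tau> i < \<tau> (Suc i)) \<longrightarrow>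
        prob_space.indep_vars M (\<lambda>_. borel) (\<lambda>i \<omega>. W (\<tau> (Suc i)) \<omega> - W (\<tau> i) \<omega>) {..<m})"

text \<open>\<open>normalized_incr W h t\<close> is the variable \<open>X\<close> with \<open>sqrt h * X = W (t + h) - W t\<close>.\<close>

definition normalized_incr :: "(real \<Rightarrow> 'w \<Rightarrow> real) \<Rightarrow> real \<Rightarrow> real \<Rightarrow> 'w \<Rightarrow> real" where
  "normalized_incr W h t \<omega> = (W (t + h) \<omega> - W t \<omega>) / sqrt h"

text \<open>One step of size \<open>h\<close> of the stochastic theta-method for \<open>du = lam u dt + mu u dW\<close> is
  multiplication by \<open>theta_drift \<theta> h lam + theta_diffusion \<theta> h lam mu * X\<close> with \<open>X\<close> the
  normalized Wiener increment of that step.\<close>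

definition theta_drift :: "real \<Rightarrow> real \<Rightarrow> complex \<Rightarrow> complex" where
  "theta_drift \<theta> h lam =
     (1 + complex_of_real ((1 - \<theta>) * h) * lam) / (1 - complex_of_real (\<theta> * h) * lam)"

definition theta_diffusion :: "real \<Rightarrow> real \<Rightarrow> complex \<Rightarrow> complex \<Rightarrow> complex" where
  "theta_diffusion \<theta> h lam mu =
     (complex_of_real (sqrt h) * mu) / (1 - complex_of_real (\<theta> * h) * lam)"

text \<open>The propagators over \<open>[n * \<Delta>T, (n + 1) * \<Delta>T]\<close> act as multiplication by these random
  factors. The fine one performs two steps of size \<open>\<Delta>t\<close>; its four arguments before \<open>n\<close> are
  \<open>\<Delta>T\<close>, \<open>\<Delta>t\<close>, \<open>a\<close>, \<open>b\<close>.\<close>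

definition fine_factor ::
  "(real \<Rightarrow> 'w \<Rightarrow> real) \<Rightarrow> real \<Rightarrow> real \<Rightarrow> complex \<Rightarrow> complex \<Rightarrow> nat \<Rightarrow> 'w \<Rightarrow> complex" where
  "fine_factor W \<Delta>T \<Delta>t a b n \<omega> =
     (a + b * complex_of_real (normalized_incr W \<Delta>t (real n * \<Delta>T + \<Delta>t) \<omega>)) *
     (a + b * complex_of_real (normalized_incr W \<Delta>t (real n * \<Delta>T) \<omega>))"

definition coarse_factor ::
  "(real \<Rightarrow> 'w \<Rightarrow> real) \<Rightarrow> real \<Rightarrow> complex \<Rightarrow> complex \<Rightarrow> nat \<Rightarrow> 'w \<Rightarrow> complex" where
  "coarse_factor W \<Delta>T A B n \<omega> =
     A + B * complex_of_real (normalized_incr W \<Delta>T (real n * \<Delta>T) \<omega>)"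

definition fine_solution ::
  "'w measure \<Rightarrow> nat \<Rightarrow> complex \<Rightarrow> (nat \<Rightarrow> 'w \<Rightarrow> complex) \<Rightarrow> (nat \<Rightarrow> 'w \<Rightarrow> complex) \<Rightarrow> bool" where
  "fine_solution M N u0 F u \<longleftrightarrow>
     (\<forall>\<omega>\<in>space M. u 0 \<omega> = u0 \<and> (\<forall>n<N. u (Suc n) \<omega> = F n \<omega> * u n \<omega>))"

text \<open>\<open>U k n\<close> and \<open>\<alpha> k n\<close> stand for the iterates with iteration index \<open>k\<close> (superscript) and
  time index \<open>n\<close> (subscript). How \<open>\<alpha> k n\<close> is drawn for \<open>k, n \<ge> 1\<close> is left to the sampling rule.\<close>

definition sparareal_scheme ::
  "'w measure \<Rightarrow> nat \<Rightarrow> complex \<Rightarrow> (nat \<Rightarrow> 'w \<Rightarrow> complex) \<Rightarrow> (nat \<Rightarrow> 'w \<Rightarrow> complex) \<Rightarrow>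
   (nat \<Rightarrow> nat \<Rightarrow> 'w \<Rightarrow> complex) \<Rightarrow> (nat \<Rightarrow> nat \<Rightarrow> 'w \<Rightarrow> complex) \<Rightarrow> bool" where
  "sparareal_scheme M N u0 F G U \<alpha> \<longleftrightarrow>
     (\<forall>\<omega>\<in>space M.
        (\<forall>k. U k 0 \<omega> = u0) \<and>
        (\<forall>n<N. U 0 (Suc n) \<omega> = G n \<omega> * U 0 n \<omega>) \<and>
        (\<forall>k. \<forall>n<N. U (Suc k) (Suc n) \<omega> =
           G n \<omega> * U (Suc k) n \<omega> + (F n \<omega> - G n \<omega>) * \<alpha> k n \<omega>) \<and>
        (\<forall>n<N. \<alpha> 0 n \<omega> = U 0 n \<omega>) \<and>
        (\<forall>k. \<alpha> k 0 \<omega> = u0))"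

definition sparareal_sigma ::
  "(nat \<Rightarrow> 'w \<Rightarrow> complex) \<Rightarrow> (nat \<Rightarrow> nat \<Rightarrow> 'w \<Rightarrow> complex) \<Rightarrow> nat \<Rightarrow> nat \<Rightarrow> 'w \<Rightarrow> real" where
  "sparareal_sigma G U k n \<omega> =
     cmod (G (n - 1) \<omega> * U k (n - 1) \<omega> - G (n - 1) \<omega> * U (k - 1) (n - 1) \<omega>)"

text \<open>A family of mutually independent variables \<open>\<xi> k n\<close> (\<open>k \<ge> 1\<close>, \<open>1 \<le> n < N\<close>) with common
  Lebesgue density \<open>f\<close>; the last conjunct says that the sigma-algebra generated by the
  whole family is independent of the one generated by \<open>W\<close> on \<open>[0, T]\<close>.\<close>

definition sampling_variables ::
  "'w measure \<Rightarrow> real \<Rightarrow> (real \<Rightarrow> 'w \<Rightarrow> real) \<Rightarrow> nat \<Rightarrow> (real \<Rightarrow> ennreal) \<Rightarrow>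
   (nat \<Rightarrow> nat \<Rightarrow> 'w \<Rightarrow> real) \<Rightarrow> bool" where
  "sampling_variables M T W N f \<xi> \<longleftrightarrow>
     (let I = {1..} \<times> {1..<N} in
       (\<forall>(k, n)\<in>I. distributed M lborel (\<xi> k n) f) \<and>
       prob_space.indep_vars M (\<lambda>_. borel) (\<lambda>(k, n). \<xi> k n) I \<and>
       prob_space.indep_set M
         (sets (vimage_algebra (space M) (\<lambda>\<omega>. \<lambda>(k, n)\<in>I. \<xi> k n \<omega>) (PiM I (\<lambda>_. borel))))
         (sets (vimage_algebra (space M) (\<lambda>\<omega>. \<lambda>t\<in>{0..T}. W t \<omega>) (PiM {0..T} (\<lambda>_. borel)))))"

definition sampling_rule1 ::
  "'w measure \<Rightarrow> real \<Rightarrow> (real \<Rightarrow> 'w \<Rightarrow> real) \<Rightarrow> nat \<Rightarrow>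
   (nat \<Rightarrow> 'w \<Rightarrow> complex) \<Rightarrow> (nat \<Rightarrow> 'w \<Rightarrow> complex) \<Rightarrow>
   (nat \<Rightarrow> nat \<Rightarrow> 'w \<Rightarrow> complex) \<Rightarrow> (nat \<Rightarrow> nat \<Rightarrow> 'w \<Rightarrow> complex) \<Rightarrow> bool" where
  "sampling_rule1 M T W N F G U \<alpha> \<longleftrightarrow>
     (\<exists>z. sampling_variables M T W N (\<lambda>x. ennreal (normal_density 0 1 x)) z \<and>
        (\<forall>k\<ge>1. \<forall>n\<in>{1..<N}. \<forall>\<omega>\<in>space M.
           \<alpha> k n \<omega> = F (n - 1) \<omega> * U (k - 1) (n - 1) \<omega>
             + complex_of_real (sparareal_sigma G U k n \<omega> * z k n \<omega>)))"

definition sampling_rule3 ::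
  "'w measure \<Rightarrow> real \<Rightarrow> (real \<Rightarrow> 'w \<Rightarrow> real) \<Rightarrow> nat \<Rightarrow>
   (nat \<Rightarrow> 'w \<Rightarrow> complex) \<Rightarrow> (nat \<Rightarrow> 'w \<Rightarrow> complex) \<Rightarrow>
   (nat \<Rightarrow> nat \<Rightarrow> 'w \<Rightarrow> complex) \<Rightarrow> (nat \<Rightarrow> nat \<Rightarrow> 'w \<Rightarrow> complex) \<Rightarrow> bool" where
  "sampling_rule3 M T W N F G U \<alpha> \<longleftrightarrow>
     (\<exists>w. sampling_variables M T W N (\<lambda>x. indicator {0..1} x) w \<and>
        (\<forall>k\<ge>1. \<forall>n\<in>{1..<N}. \<forall>\<omega>\<in>space M.
           \<alpha> k n \<omega> = F (n - 1) \<omega> * U (k - 1) (n - 1) \<omega>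
             + complex_of_real (sqrt 3 * sparareal_sigma G U k n \<omega> * (2 * w k n \<omega> - 1))))"

definition mean_square_error ::
  "'w measure \<Rightarrow> (nat \<Rightarrow> 'w \<Rightarrow> complex) \<Rightarrow> (nat \<Rightarrow> nat \<Rightarrow> 'w \<Rightarrow> complex) \<Rightarrow> nat \<Rightarrow> nat \<Rightarrow> real" where
  "mean_square_error M u U k n = prob_space.expectation M (\<lambda>\<omega>. (cmod (U k n \<omega> - u n \<omega>))\<^sup>2)"

definition sup_error ::
  "'w measure \<Rightarrow> nat \<Rightarrow> (nat \<Rightarrow> 'w \<Rightarrow> complex) \<Rightarrow> (nat \<Rightarrow> nat \<Rightarrow> 'w \<Rightarrow> complex) \<Rightarrow> nat \<Rightarrow> real" where
  "sup_error M N u U k = (SUP n\<in>{0..N}. mean_square_error M u U k n)"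

end

theory Submission
  imports Defs
begin

text \<open>Write \<open>D = F - G\<close> for the correction and \<open>e k n = U k n - u n\<close> for the error. Subtracting
\<open>u (n+1) = G n * u n + D n * u n\<close> from the scheme gives
\<open>e (k+1) (n+1) = G n * e (k+1) n + D n * (alph k n - u n)\<close>,
and the pair \<open>(F n, G n)\<close> depends on two Wiener increments that are independent of both \<open>e (k+1) n\<close>
and \<open>alph k n - u n\<close>. Expanding the square and estimating the mixed term by Young's inequality
bounds the mean square of the left-hand side by \<open>\<alpha>\<close> and \<open>\<beta>\<close> times those of the two variables on the
right: \<open>\<alpha>\<close> and \<open>\<beta>\<close> are the second moments of \<open>G\<close> and \<open>D\<close>, each increased by the modulus of
the mixed moment of \<open>G\<close> and \<open>D\<close>. For \<open>k, n \<ge> 1\<close> the sampling error \<open>alph k n - u n\<close> is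
\<open>F (n-1) * e (k-1) (n-1)\<close> plus an independent variable of second moment \<open>1\<close> scaled by
\<open>cmod (G (n-1) * (e k (n-1) - e (k-1) (n-1)))\<close>, which brings in \<open>\<kappa>\<close> and \<open>\<gamma>\<close>, the second moments
of \<open>F\<close> and \<open>G\<close>. With \<open>E k\<close> the supremum over \<open>n\<close> of the mean square of \<open>e k n\<close>, the result is
\<open>E (k+2) \<le> p * E (k+1) + q * E k\<close> for \<open>p = 4 * \<beta> * \<gamma> / (1 - \<alpha>)\<close> and
\<open>q = (2 * \<beta> * \<kappa> + 4 * \<beta> * \<gamma>) / (1 - \<alpha>)\<close>,
and the base of the power in the theorem is the larger root \<open>r\<close> of \<open>r^2 = p * r + q\<close>.

The delicate point is the start \<open>E 1 \<le> r * E 0\<close> of the induction. The argument above gives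
\<open>E 1 \<le> \<beta> / (1 - \<alpha>) * E 0\<close>, but \<open>\<beta> / (1 - \<alpha>)\<close> may exceed \<open>r\<close>, for instance when \<open>\<gamma> < 1/4\<close>
and \<open>\<alpha>\<close> is close enough to \<open>1\<close>. A differently weighted Young inequality for the same recursion
gives in addition \<open>E 1 \<le> 4 * \<gamma> * E 1 + (2 * \<kappa> + 4 * \<gamma>) * E 0\<close>. The product of the two
inequalities is exactly \<open>(E 1)^2 \<le> p * E 1 * E 0 + q * (E 0)^2\<close>, so that \<open>E 1 / E 0\<close> is at
most \<open>r\<close>. The lemma \<open>two_step_recursion_bound\<close> does the induction from this quadratic start,
\<open>random_linear_combination\<close> proves both mean square estimates, and \<open>sup_error_bound\<close> combines
them.

On the probabilistic side, all Wiener increments over the fine steps and all sampling variables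
are gathered into a single independent family. A random variable is then described by the set of
members of the family on which it depends, and disjoint sets give independence.\<close>

section \<open>Two-step recursions\<close>

lemma le_larger_root:
  fixes x p q :: real
  assumes "x\<^sup>2 \<le> p * x + q"
  shows "x \<le> (p + sqrt (p\<^sup>2 + 4 * q)) / 2"
proof -
  have "(2 * x - p)\<^sup>2 \<le> p\<^sup>2 + 4 * q"
    using assms by (simp add: power2_eq_square algebra_simps)
  from real_le_rsqrt[OF this] show ?thesis by simp
qed

text \<open>The base of the power is the larger root of \<open>r^2 = p * r + q\<close>, so powers of \<open>r\<close> solve the
recursion with equality. The start \<open>E 1 \<le> r * E 0\<close> is encoded as a quadratic inequality for
\<open>E 1 / E 0\<close>, cleared of denominators, since \<open>r\<close> itself is awkward to compare with.\<close>
lemma two_step_recursion_bound: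
  fixes E :: "nat \<Rightarrow> real" and p q :: real
  assumes nonneg: "\<And>k. 0 \<le> E k" and p: "0 \<le> p" and q: "0 \<le> q"
    and first: "(E 1)\<^sup>2 \<le> p * E 1 * E 0 + q * (E 0)\<^sup>2"
    and step: "\<And>k. E (Suc (Suc k)) \<le> p * E (Suc k) + q * E k"
  shows "E k \<le> E 0 * ((p + sqrt (p\<^sup>2 + 4 * q)) / 2) ^ k"
proof -
  define r where "r = (p + sqrt (p\<^sup>2 + 4 * q)) / 2"
  have r0: "0 \<le> r" using p q by (simp add: r_def)
  have r2: "r\<^sup>2 = p * r + q"
  proof -
    have "(sqrt (p\<^sup>2 + 4 * q))\<^sup>2 = p\<^sup>2 + 4 * q" using q by simp
    moreover have "sqrt (p\<^sup>2 + 4 * q) = 2 * r - p" by (simp add: r_def field_simps)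
    ultimately have "(2 * r - p)\<^sup>2 = p\<^sup>2 + 4 * q" by metis
    then show ?thesis by (simp add: power2_eq_square algebra_simps)
  qed
  have one: "E 1 \<le> E 0 * r"
  proof (cases "E 0 = 0")
    case True
    then show ?thesis using first by simp
  next
    case False
    then have pos: "0 < E 0" using nonneg[of 0] by simp
    have "(E 1 / E 0)\<^sup>2 \<le> p * (E 1 / E 0) + q"
      using first pos by (simp add: power_divide field_simps power2_eq_square)
    then have "E 1 / E 0 \<le> r" unfolding r_def by (rule le_larger_root)
    then show ?thesis using pos by (simp add: field_simps)
  qed
  have "E k \<le> E 0 * r ^ k \<and> E (Suc k) \<le> E 0 * r ^ Suc k"
  proof (induction k)
    case 0
    then show ?case using one by simp
  next
    case (Suc k)
    have "E (Suc (Suc k)) \<le> p * E (Suc k) + q * E k" by (rule step)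
    also have "\<dots> \<le> p * (E 0 * r ^ Suc k) + q * (E 0 * r ^ k)"
      using Suc p q by (intro add_mono mult_left_mono) auto
    also have "\<dots> = E 0 * r ^ k * (p * r + q)" by (simp add: algebra_simps)
    also have "\<dots> = E 0 * r ^ Suc (Suc k)" by (simp add: r2[symmetric] power2_eq_square)
    finally show ?case using Suc by blast
  qed
  then show ?thesis unfolding r_def by blast
qed

section \<open>Squared norms of sums\<close>

lemma norm_add_square_le: "(cmod (x + y))\<^sup>2 \<le> 2 * (cmod x)\<^sup>2 + 2 * (cmod y)\<^sup>2"
proof -
  have "(cmod (x + y))\<^sup>2 \<le> (cmod x + cmod y)\<^sup>2" by (simp add: norm_triangle_ineq power_mono)
  also have "\<dots> \<le> 2 * (cmod x)\<^sup>2 + 2 * (cmod y)\<^sup>2"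
    using zero_le_power2[of "cmod x - cmod y"] by (simp add: power2_eq_square algebra_simps)
  finally show ?thesis .
qed

lemma norm_add_square: "(cmod (p + q))\<^sup>2 = (cmod p)\<^sup>2 + (cmod q)\<^sup>2 + 2 * Re (p * cnj q)"
  unfolding cmod_power2 by (simp add: power2_eq_square algebra_simps)

lemma norm_diff_square: "(cmod (p - q))\<^sup>2 = (cmod p)\<^sup>2 + (cmod q)\<^sup>2 - 2 * Re (p * cnj q)"
  using norm_add_square[of p "- q"] by simp

text \<open>The weights are reciprocal in the sense of Young's inequality (\<open>1/4 + 3/4 = 1\<close>). The weight \<open>4\<close>
is the one that produces the coefficient \<open>4 * \<gamma>\<close> of the quadratic start, and \<open>4/3\<close> leaves enough
room for the bound of \<open>correction_moments\<close>.\<close>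
lemma norm_add_square_le_weighted: "(cmod (p + q))\<^sup>2 \<le> 4 * (cmod p)\<^sup>2 + 4 / 3 * (cmod q)\<^sup>2"
proof -
  have "0 \<le> (cmod (3 * p - q))\<^sup>2" by simp
  also have "\<dots> = 9 * (cmod p)\<^sup>2 + (cmod q)\<^sup>2 - 6 * Re (p * cnj q)"
    unfolding norm_diff_square by (simp add: norm_mult power_mult_distrib)
  finally show ?thesis unfolding norm_add_square by simp
qed

section \<open>Families of independent variables\<close>

lemma measurable_vimage_algebra_component:
  assumes "t \<in> S"
  shows "f t \<in> borel_measurable (vimage_algebra \<Omega> (\<lambda>\<omega>. \<lambda>t\<in>S. f t \<omega>) (PiM S (\<lambda>_. borel)))"
proof -
  have "(\<lambda>\<omega>. \<lambda>t\<in>S. f t \<omega>) \<in> measurable (vimage_algebra \<Omega> (\<lambda>\<omega>. \<lambda>t\<in>S. f t \<omega>) (PiM S (\<lambda>_. borel))) (PiM S (\<lambda>_. borel))"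
    by (rule measurable_vimage_algebra1) (auto simp: space_PiM)
  from measurable_comp[OF this measurable_component_singleton[OF assms]]
  show ?thesis using assms by (simp add: comp_def)
qed

text \<open>A finite intersection of events splits into an intersection over each side of the sum. The two
parts lie in the sigma-algebras \<open>SX\<close> and \<open>SY\<close>, hence are independent, and each of them factors
within its own family.\<close>
lemma (in prob_space) indep_vars_Plus:
  assumes X: "indep_vars (\<lambda>_. borel) X I" and Y: "indep_vars (\<lambda>_. borel) Y J"
    and ind: "indep_set (sets SX) (sets SY)"
    and sp: "space SX = space M" "space SY = space M"
    and SX: "\<And>i. i \<in> I \<Longrightarrow> X i \<in> borel_measurable SX"
    and SY: "\<And>j. j \<in> J \<Longrightarrow> Y j \<in> borel_measurable SY"
  shows "indep_vars (\<lambda>_. borel) (case_sum X Y) (I <+> J)"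
proof -
  define FX where "FX = (\<lambda>i. {X i -` A \<inter> space M | A. A \<in> sets borel})"
  define FY where "FY = (\<lambda>j. {Y j -` A \<inter> space M | A. A \<in> sets borel})"
  have iX: "indep_sets FX I" and iY: "indep_sets FY J"
    using X Y unfolding indep_vars_def2 FX_def FY_def by auto
  have rX: "\<And>i. i \<in> I \<Longrightarrow> random_variable borel (X i)"
    and rY: "\<And>j. j \<in> J \<Longrightarrow> random_variable borel (Y j)"
    using X Y unfolding indep_vars_def2 by auto
  have FSX: "FX i \<subseteq> sets SX" if "i \<in> I" for i
    using measurable_sets[OF SX[OF that]] by (auto simp: FX_def sp)
  have FSY: "FY j \<subseteq> sets SY" if "j \<in> J" for j
    using measurable_sets[OF SY[OF that]] by (auto simp: FY_def sp)
  have "indep_sets (case_sum FX FY) (I <+> J)"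
  proof (rule indep_setsI)
    fix i assume "i \<in> I <+> J"
    then show "case_sum FX FY i \<subseteq> events"
      using indep_setD_ev1[OF ind] indep_setD_ev2[OF ind] FSX FSY by (auto split: sum.splits) blast+
  next
    fix E K
    assume K: "K \<noteq> {}" "K \<subseteq> I <+> J" "finite K" and E: "\<forall>j\<in>K. E j \<in> case_sum FX FY j"
    define K1 where "K1 = Inl -` K"
    define K2 where "K2 = Inr -` K"
    have KK: "K = Inl ` K1 \<union> Inr ` K2" unfolding K1_def K2_def
      using K(2) by (auto simp: image_iff)
    have fin: "finite K1" "finite K2" unfolding K1_def K2_def
      using K(3) by (auto intro: finite_vimageI)
    have sub: "K1 \<subseteq> I" "K2 \<subseteq> J" using K(2) unfolding K1_def K2_def by auto
    have E1: "\<forall>i\<in>K1. E (Inl i) \<in> FX i" using E by (fastforce simp: K1_def)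
    have E2: "\<forall>j\<in>K2. E (Inr j) \<in> FY j" using E by (fastforce simp: K2_def)
    have p1: "prob (\<Inter>i\<in>K1. E (Inl i)) = (\<Prod>i\<in>K1. prob (E (Inl i)))" if "K1 \<noteq> {}"
      using indep_setsD[OF iX sub(1) that fin(1), of "\<lambda>i. E (Inl i)"] E1 by auto
    have p2: "prob (\<Inter>i\<in>K2. E (Inr i)) = (\<Prod>i\<in>K2. prob (E (Inr i)))" if "K2 \<noteq> {}"
      using indep_setsD[OF iY sub(2) that fin(2), of "\<lambda>i. E (Inr i)"] E2 by auto
    have prod: "(\<Prod>j\<in>K. prob (E j)) = (\<Prod>i\<in>K1. prob (E (Inl i))) * (\<Prod>i\<in>K2. prob (E (Inr i)))"
      unfolding KK using fin by (subst prod.union_disjoint) (auto simp: prod.reindex)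
    have s1: "(\<Inter>i\<in>K1. E (Inl i)) \<in> sets SX" if "K1 \<noteq> {}"
      using that fin E1 FSX sub by (intro sets.finite_INT) auto
    have s2: "(\<Inter>i\<in>K2. E (Inr i)) \<in> sets SY" if "K2 \<noteq> {}"
      using that fin E2 FSY sub by (intro sets.finite_INT) auto
    have int: "(\<Inter>j\<in>K. E j) = (\<Inter>i\<in>K1. E (Inl i)) \<inter> (\<Inter>i\<in>K2. E (Inr i))"
      unfolding KK by auto
    show "prob (\<Inter>j\<in>K. E j) = (\<Prod>j\<in>K. prob (E j))"
    proof (cases "K1 = {} \<or> K2 = {}")
      case True
      then consider "K1 = {}" "K2 \<noteq> {}" | "K2 = {}" "K1 \<noteq> {}" using K(1) KK by auto
      then show ?thesis unfolding int prod by cases (simp_all add: p1 p2)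
    next
      case False
      then show ?thesis unfolding int prod
        using indep_setD[OF ind s1 s2] p1 p2 by simp
    qed
  qed
  moreover have "case_sum FX FY = (\<lambda>i. {case_sum X Y i -` A \<inter> space M | A. A \<in> sets borel})"
    by (auto simp: FX_def FY_def fun_eq_iff split: sum.splits)
  ultimately show ?thesis unfolding indep_vars_def2 using rX rY by (auto split: sum.splits)
qed

locale independent_family = prob_space M for M :: "'w measure" +
  fixes X :: "'i \<Rightarrow> 'w \<Rightarrow> real" and I :: "'i set"
  assumes indep: "indep_vars (\<lambda>_. borel) X I"
begin

text \<open>The sigma-algebra generated by the variables \<open>X i\<close> with \<open>i \<in> A\<close>. Being measurable with respect
to \<open>info A\<close> means being a function of these variables, and the measurability rules make this notion
closed under arithmetic.\<close>
definition info :: "'i set \<Rightarrow> 'w measure" where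
  "info A = vimage_algebra (space M) (\<lambda>\<omega>. \<lambda>i\<in>A. X i \<omega>) (PiM A (\<lambda>_. borel))"

lemma space_info [simp]: "space (info A) = space M"
  by (simp add: info_def)

lemma measurable_info_component: "i \<in> A \<Longrightarrow> X i \<in> borel_measurable (info A)"
  unfolding info_def by (rule measurable_vimage_algebra_component)

lemma sets_info_subset:
  assumes "space N = space M" and "\<And>i. i \<in> A \<Longrightarrow> X i \<in> borel_measurable N"
  shows "sets (info A) \<subseteq> sets N"
proof -
  have "(\<lambda>\<omega>. \<lambda>i\<in>A. X i \<omega>) \<in> measurable N (PiM A (\<lambda>_. borel))"
    using assms(2) by (intro measurable_restrict) auto
  then show ?thesis
    unfolding info_def sets_vimage_algebra assms(1)[symmetric]
    by (intro sets.sigma_sets_subset) (auto intro: measurable_sets)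
qed

lemma measurable_info_mono:
  assumes "A \<subseteq> B" "f \<in> measurable (info A) N"
  shows "f \<in> measurable (info B) N"
proof -
  have "sets (info A) \<subseteq> sets (info B)"
    using assms(1) by (intro sets_info_subset) (auto intro: measurable_info_component)
  then show ?thesis using assms(2) by (auto simp: measurable_def)
qed

lemma random_variable_info:
  assumes "A \<subseteq> I" "f \<in> measurable (info A) N"
  shows "f \<in> measurable M N"
proof -
  have "sets (info A) \<subseteq> sets M"
    using assms(1) indep by (intro sets_info_subset) (auto simp: indep_vars_def2)
  then show ?thesis using assms(2) by (auto simp: measurable_def)
qed

lemma indep_var_info:
  assumes f: "f \<in> borel_measurable (info A)" and g: "g \<in> borel_measurable (info B)"
    and AB: "A \<inter> B = {}" "A \<subseteq> I" "B \<subseteq> I"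
  shows "indep_var borel f borel g"
proof -
  have eq: "sigma_sets (space M) {(\<lambda>\<omega>. \<lambda>i\<in>C. X i \<omega>) -` E \<inter> space M | E. E \<in> sets (PiM C (\<lambda>_. borel))}
      = sets (info C)" for C
    by (simp add: info_def sets_vimage_algebra)
  have ind: "indep_set (sets (info A)) (sets (info B))"
    using indep_var_restrict[OF indep AB] unfolding indep_var_eq eq by blast
  have sub: "sigma_sets (space M) {h -` E \<inter> space M | E. E \<in> sets borel} \<subseteq> sets (info C)"
    if "h \<in> borel_measurable (info C)" for C and h :: "'w \<Rightarrow> 'z::topological_space"
    using measurable_sets[OF that] sets.sigma_sets_subset[of _ "info C"]
    by (intro sets.sigma_sets_subset[of _ "info C", simplified]) auto
  show ?thesis unfolding indep_var_eq
  proof (intro conjI)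
    show "random_variable borel f" "random_variable borel g"
      using random_variable_info f g AB by blast+
    show "indep_set (sigma_sets (space M) {f -` E \<inter> space M | E. E \<in> sets borel})
        (sigma_sets (space M) {g -` E \<inter> space M | E. E \<in> sets borel})"
      using ind sub[OF f] sub[OF g] unfolding indep_sets2_eq by blast
  qed
qed

lemma integral_mult_info:
  fixes f g :: "'w \<Rightarrow> 'z::{real_normed_field, banach, second_countable_topology}"
  assumes "f \<in> borel_measurable (info A)" "g \<in> borel_measurable (info B)"
    and "A \<inter> B = {}" "A \<subseteq> I" "B \<subseteq> I" and "integrable M f" "integrable M g"
  shows "integrable M (\<lambda>\<omega>. f \<omega> * g \<omega>)"
    and "expectation (\<lambda>\<omega>. f \<omega> * g \<omega>) = expectation f * expectation g"
  using indep_var_integrable indep_var_lebesgue_integral indep_var_info assms by blast+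

abbreviation msq :: "('w \<Rightarrow> complex) \<Rightarrow> real" where
  "msq f \<equiv> expectation (\<lambda>\<omega>. (cmod (f \<omega>))\<^sup>2)"

text \<open>Square integrable functions of the variables with index in \<open>A\<close>. The condition \<open>A \<subseteq> I\<close> is part
of the notion so that disjointness of the index sets is all that independence needs.\<close>
definition L2 :: "'i set \<Rightarrow> ('w \<Rightarrow> complex) \<Rightarrow> bool" where
  "L2 A f \<longleftrightarrow> A \<subseteq> I \<and> f \<in> borel_measurable (info A) \<and> integrable M (\<lambda>\<omega>. (cmod (f \<omega>))\<^sup>2)"

lemma L2_D:
  assumes "L2 A f"
  shows "A \<subseteq> I" "f \<in> borel_measurable (info A)" "f \<in> borel_measurable M"
    "integrable M (\<lambda>\<omega>. (cmod (f \<omega>))\<^sup>2)"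
  using assms random_variable_info unfolding L2_def by blast+

lemma L2_mono: "L2 A f \<Longrightarrow> A \<subseteq> B \<Longrightarrow> B \<subseteq> I \<Longrightarrow> L2 B f"
  unfolding L2_def using measurable_info_mono by blast

lemma L2_cong:
  assumes "\<And>\<omega>. \<omega> \<in> space M \<Longrightarrow> f \<omega> = g \<omega>" "L2 A g"
  shows "L2 A f"
proof -
  have "f \<in> borel_measurable (info A) \<longleftrightarrow> g \<in> borel_measurable (info A)"
    using assms(1) by (intro measurable_cong) auto
  moreover have "integrable M (\<lambda>\<omega>. (cmod (f \<omega>))\<^sup>2) \<longleftrightarrow> integrable M (\<lambda>\<omega>. (cmod (g \<omega>))\<^sup>2)"
    using assms(1) by (intro Bochner_Integration.integrable_cong) auto
  ultimately show ?thesis using assms(2) unfolding L2_def by simp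
qed

lemma msq_cong: "(\<And>\<omega>. \<omega> \<in> space M \<Longrightarrow> f \<omega> = g \<omega>) \<Longrightarrow> msq f = msq g"
  by (intro Bochner_Integration.integral_cong) auto

lemma L2_const: "A \<subseteq> I \<Longrightarrow> L2 A (\<lambda>_. c)"
  unfolding L2_def by simp

lemma L2_of_real:
  assumes "A \<subseteq> I" "f \<in> borel_measurable (info A)" "integrable M (\<lambda>\<omega>. (f \<omega>)\<^sup>2)"
  shows "L2 A (\<lambda>\<omega>. complex_of_real (f \<omega>))"
  using assms unfolding L2_def by auto

lemma L2_add:
  assumes "L2 A f" "L2 A g"
  shows "L2 A (\<lambda>\<omega>. f \<omega> + g \<omega>)" and "msq (\<lambda>\<omega>. f \<omega> + g \<omega>) \<le> 2 * msq f + 2 * msq g"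
proof -
  note f = L2_D[OF assms(1)] and g = L2_D[OF assms(2)]
  have bound: "integrable M (\<lambda>\<omega>. 2 * (cmod (f \<omega>))\<^sup>2 + 2 * (cmod (g \<omega>))\<^sup>2)"
    using f(4) g(4) by simp
  have int: "integrable M (\<lambda>\<omega>. (cmod (f \<omega> + g \<omega>))\<^sup>2)"
    by (rule Bochner_Integration.integrable_bound[OF bound])
      (use f(3) g(3) norm_add_square_le in \<open>auto intro!: AE_I2\<close>)
  then show "L2 A (\<lambda>\<omega>. f \<omega> + g \<omega>)" unfolding L2_def using f g by simp
  have "msq (\<lambda>\<omega>. f \<omega> + g \<omega>) \<le> expectation (\<lambda>\<omega>. 2 * (cmod (f \<omega>))\<^sup>2 + 2 * (cmod (g \<omega>))\<^sup>2)"
    using norm_add_square_le by (intro integral_mono int bound) auto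
  then show "msq (\<lambda>\<omega>. f \<omega> + g \<omega>) \<le> 2 * msq f + 2 * msq g"
    using f(4) g(4) by simp
qed

lemma L2_uminus: "L2 A f \<Longrightarrow> L2 A (\<lambda>\<omega>. - f \<omega>)"
  unfolding L2_def by auto

lemma L2_diff:
  assumes "L2 A f" "L2 A g"
  shows "L2 A (\<lambda>\<omega>. f \<omega> - g \<omega>)" and "msq (\<lambda>\<omega>. f \<omega> - g \<omega>) \<le> 2 * msq f + 2 * msq g"
  using L2_add[OF assms(1) L2_uminus[OF assms(2)]] by auto

lemma L2_mult:
  assumes f: "L2 A f" and g: "L2 B g" and AB: "A \<inter> B = {}"
  shows "L2 (A \<union> B) (\<lambda>\<omega>. f \<omega> * g \<omega>)" and "msq (\<lambda>\<omega>. f \<omega> * g \<omega>) = msq f * msq g"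
proof -
  note f = L2_D[OF f] and g = L2_D[OF g]
  have m: "(\<lambda>\<omega>. (cmod (f \<omega>))\<^sup>2) \<in> borel_measurable (info A)"
    "(\<lambda>\<omega>. (cmod (g \<omega>))\<^sup>2) \<in> borel_measurable (info B)"
    using f(2) g(2) by auto
  note * = integral_mult_info[OF m AB f(1) g(1) f(4) g(4)]
  show "msq (\<lambda>\<omega>. f \<omega> * g \<omega>) = msq f * msq g"
    using *(2) by (simp add: norm_mult power_mult_distrib)
  have "f \<in> borel_measurable (info (A \<union> B))" "g \<in> borel_measurable (info (A \<union> B))"
    using f(2) g(2) by (auto intro: measurable_info_mono[rotated])
  then show "L2 (A \<union> B) (\<lambda>\<omega>. f \<omega> * g \<omega>)"
    using *(1) f(1) g(1) unfolding L2_def by (simp add: norm_mult power_mult_distrib)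
qed

lemma L2_inner:
  assumes "L2 A f" "L2 A g"
  shows "integrable M (\<lambda>\<omega>. f \<omega> * cnj (g \<omega>))"
    and "2 * cmod (expectation (\<lambda>\<omega>. f \<omega> * cnj (g \<omega>))) \<le> msq f + msq g"
proof -
  note f = L2_D[OF assms(1)] and g = L2_D[OF assms(2)]
  have le: "2 * cmod (x * cnj y) \<le> (cmod x)\<^sup>2 + (cmod y)\<^sup>2" for x y
    using zero_le_power2[of "cmod x - cmod y"]
    by (simp add: norm_mult power2_eq_square algebra_simps)
  have bound: "integrable M (\<lambda>\<omega>. (cmod (f \<omega>))\<^sup>2 + (cmod (g \<omega>))\<^sup>2)"
    using f(4) g(4) by simp
  show int: "integrable M (\<lambda>\<omega>. f \<omega> * cnj (g \<omega>))"
  proof (rule Bochner_Integration.integrable_bound[OF bound])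
    show "(\<lambda>\<omega>. f \<omega> * cnj (g \<omega>)) \<in> borel_measurable M"
      using f(3) g(3) by (intro borel_measurable_times borel_measurable_continuous_on[of cnj]) (auto intro!: continuous_intros)
    show "AE \<omega> in M. norm (f \<omega> * cnj (g \<omega>)) \<le> norm ((cmod (f \<omega>))\<^sup>2 + (cmod (g \<omega>))\<^sup>2)"
    proof (rule AE_I2)
      fix \<omega>
      show "norm (f \<omega> * cnj (g \<omega>)) \<le> norm ((cmod (f \<omega>))\<^sup>2 + (cmod (g \<omega>))\<^sup>2)"
        using le[of "f \<omega>" "g \<omega>"] norm_ge_zero[of "f \<omega> * cnj (g \<omega>)"] unfolding real_norm_def by linarith
    qed
  qed
  have "2 * cmod (expectation (\<lambda>\<omega>. f \<omega> * cnj (g \<omega>))) \<le> 2 * expectation (\<lambda>\<omega>. cmod (f \<omega> * cnj (g \<omega>)))"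
    using integral_norm_bound by simp
  also have "\<dots> = expectation (\<lambda>\<omega>. 2 * cmod (f \<omega> * cnj (g \<omega>)))" by simp
  also have "\<dots> \<le> expectation (\<lambda>\<omega>. (cmod (f \<omega>))\<^sup>2 + (cmod (g \<omega>))\<^sup>2)"
    using le int by (intro integral_mono bound) auto
  finally show "2 * cmod (expectation (\<lambda>\<omega>. f \<omega> * cnj (g \<omega>))) \<le> msq f + msq g"
    using f(4) g(4) by simp
qed

section \<open>Moments of one coarse interval\<close>

lemma measurable_cnj_info:
  "f \<in> borel_measurable (info A) \<Longrightarrow> (\<lambda>\<omega>. cnj (f \<omega>)) \<in> borel_measurable (info A)"
  by (rule borel_measurable_continuous_on[of cnj]) (auto intro: continuous_intros)

lemma msq_add:
  assumes f: "L2 A f" and g: "L2 A g"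
  shows "msq (\<lambda>\<omega>. f \<omega> + g \<omega>) = msq f + msq g + 2 * Re (expectation (\<lambda>\<omega>. f \<omega> * cnj (g \<omega>)))"
proof -
  define c where "c = (\<lambda>\<omega>. f \<omega> * cnj (g \<omega>))"
  have "integrable M c" unfolding c_def by (rule L2_inner(1)[OF f g])
  moreover have "msq (\<lambda>\<omega>. f \<omega> + g \<omega>) = expectation (\<lambda>\<omega>. (cmod (f \<omega>))\<^sup>2 + (cmod (g \<omega>))\<^sup>2 + 2 * Re (c \<omega>))"
    unfolding norm_add_square c_def ..
  ultimately have "msq (\<lambda>\<omega>. f \<omega> + g \<omega>) = msq f + msq g + 2 * Re (expectation c)"
    using L2_D(4)[OF f] L2_D(4)[OF g] by simp
  then show ?thesis unfolding c_def .
qed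

text \<open>The step estimate of the error recursion, for coefficients \<open>g\<close>, \<open>d\<close> independent of the pair
\<open>(x, y)\<close>. The coefficients may be correlated with each other, and so may \<open>x\<close> and \<open>y\<close>; in the first bound
the mixed term factors into the two correlations, and only that of \<open>x\<close> and \<open>y\<close> is estimated. In the
second bound the sum is split pointwise, before any expectation is taken.\<close>
lemma random_linear_combination:
  assumes g: "L2 A g" and d: "L2 A d" and x: "L2 B x" and y: "L2 B y" and AB: "A \<inter> B = {}"
  defines "h \<equiv> cmod (expectation (\<lambda>\<omega>. g \<omega> * cnj (d \<omega>)))"
  shows "L2 (A \<union> B) (\<lambda>\<omega>. g \<omega> * x \<omega> + d \<omega> * y \<omega>)"
    and "msq (\<lambda>\<omega>. g \<omega> * x \<omega> + d \<omega> * y \<omega>) \<le> (msq g + h) * msq x + (msq d + h) * msq y"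
    and "msq (\<lambda>\<omega>. g \<omega> * x \<omega> + d \<omega> * y \<omega>) \<le> 4 * msq g * msq x + 4 / 3 * msq d * msq y"
proof -
  note gx = L2_mult[OF g x AB] and dy = L2_mult[OF d y AB]
  show L2: "L2 (A \<union> B) (\<lambda>\<omega>. g \<omega> * x \<omega> + d \<omega> * y \<omega>)"
    by (rule L2_add(1)[OF gx(1) dy(1)])
  have int: "integrable M (\<lambda>\<omega>. (cmod (g \<omega> * x \<omega>))\<^sup>2)" "integrable M (\<lambda>\<omega>. (cmod (d \<omega> * y \<omega>))\<^sup>2)"
    using L2_D(4)[OF gx(1)] L2_D(4)[OF dy(1)] by auto
  note gd = L2_inner(1)[OF g d] and xy = L2_inner(1)[OF x y]
  have "(\<lambda>\<omega>. g \<omega> * cnj (d \<omega>)) \<in> borel_measurable (info A)"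
    "(\<lambda>\<omega>. x \<omega> * cnj (y \<omega>)) \<in> borel_measurable (info B)"
    using L2_D(2) measurable_cnj_info g d x y by (auto intro!: borel_measurable_times)
  note cross = integral_mult_info[OF this AB L2_D(1)[OF g] L2_D(1)[OF x] gd xy]
  have "msq (\<lambda>\<omega>. g \<omega> * x \<omega> + d \<omega> * y \<omega>) = msq g * msq x + msq d * msq y
      + 2 * Re (expectation (\<lambda>\<omega>. g \<omega> * cnj (d \<omega>) * (x \<omega> * cnj (y \<omega>))))"
    unfolding msq_add[OF gx(1) dy(1)] gx(2) dy(2) by (simp only: complex_cnj_mult mult_ac)
  also have "\<dots> = msq g * msq x + msq d * msq y
      + 2 * Re (expectation (\<lambda>\<omega>. g \<omega> * cnj (d \<omega>)) * expectation (\<lambda>\<omega>. x \<omega> * cnj (y \<omega>)))"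
    unfolding cross(2) ..
  also have "\<dots> \<le> msq g * msq x + msq d * msq y
      + h * (2 * cmod (expectation (\<lambda>\<omega>. x \<omega> * cnj (y \<omega>))))"
    using complex_Re_le_cmod[of "expectation (\<lambda>\<omega>. g \<omega> * cnj (d \<omega>)) * expectation (\<lambda>\<omega>. x \<omega> * cnj (y \<omega>))"]
    by (simp add: h_def norm_mult)
  also have "\<dots> \<le> msq g * msq x + msq d * msq y + h * (msq x + msq y)"
    using L2_inner(2)[OF x y] by (simp add: h_def mult_left_mono)
  finally show "msq (\<lambda>\<omega>. g \<omega> * x \<omega> + d \<omega> * y \<omega>) \<le> (msq g + h) * msq x + (msq d + h) * msq y"
    by (simp add: algebra_simps)
  have "msq (\<lambda>\<omega>. g \<omega> * x \<omega> + d \<omega> * y \<omega>)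
      \<le> expectation (\<lambda>\<omega>. 4 * (cmod (g \<omega> * x \<omega>))\<^sup>2 + 4 / 3 * (cmod (d \<omega> * y \<omega>))\<^sup>2)"
    using int norm_add_square_le_weighted
    by (intro integral_mono L2_D(4)[OF L2]) auto
  also have "\<dots> = 4 * msq g * msq x + 4 / 3 * msq d * msq y"
    using int gx(2) dy(2) by simp
  finally show "msq (\<lambda>\<omega>. g \<omega> * x \<omega> + d \<omega> * y \<omega>) \<le> 4 * msq g * msq x + 4 / 3 * msq d * msq y" .
qed

definition standardized :: "'i \<Rightarrow> bool" where
  "standardized i \<longleftrightarrow> i \<in> I \<and> integrable M (X i) \<and> integrable M (\<lambda>\<omega>. (X i \<omega>)\<^sup>2)
     \<and> expectation (X i) = 0 \<and> expectation (\<lambda>\<omega>. (X i \<omega>)\<^sup>2) = 1"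

abbreviation affine :: "complex \<Rightarrow> complex \<Rightarrow> 'i \<Rightarrow> 'w \<Rightarrow> complex" where
  "affine p q i \<equiv> \<lambda>\<omega>. p + q * complex_of_real (X i \<omega>)"

lemma expectation_affine:
  assumes "standardized i"
  shows "integrable M (affine p q i)" "expectation (affine p q i) = p"
  using assms unfolding standardized_def by (simp_all add: prob_space)

lemma L2_affine:
  assumes "standardized i" shows "L2 {i} (affine p q i)"
proof -
  have i: "{i} \<subseteq> I" "X i \<in> borel_measurable (info {i})"
    using assms measurable_info_component[of i "{i}"] unfolding standardized_def by auto
  have "(\<lambda>\<omega>. (cmod (affine p q i \<omega>))\<^sup>2)
      = (\<lambda>\<omega>. (cmod p)\<^sup>2 + (cmod q)\<^sup>2 * (X i \<omega>)\<^sup>2 + 2 * Re (p * cnj q) * X i \<omega>)"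
    unfolding norm_add_square by (auto simp: norm_mult power_mult_distrib algebra_simps)
  then show ?thesis
    using assms i unfolding L2_def standardized_def by simp
qed

lemma expectation_affine_mult_affine:
  assumes "standardized i"
  shows "integrable M (\<lambda>\<omega>. affine p q i \<omega> * affine r s i \<omega>)"
    and "expectation (\<lambda>\<omega>. affine p q i \<omega> * affine r s i \<omega>) = p * r + q * s"
proof -
  have eq: "(\<lambda>\<omega>. affine p q i \<omega> * affine r s i \<omega>)
      = (\<lambda>\<omega>. p * r + (p * s + q * r) * complex_of_real (X i \<omega>)
          + q * s * complex_of_real ((X i \<omega>)\<^sup>2))"
    by (simp add: fun_eq_iff power2_eq_square algebra_simps)
  have sq: "expectation (\<lambda>\<omega>. complex_of_real ((X i \<omega>)\<^sup>2)) = 1"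
    using assms unfolding standardized_def integral_complex_of_real by simp
  have int: "integrable M (\<lambda>\<omega>. complex_of_real ((X i \<omega>)\<^sup>2))" "integrable M (\<lambda>\<omega>. complex_of_real (X i \<omega>))"
    using assms unfolding standardized_def by (simp_all del: of_real_power)
  show "integrable M (\<lambda>\<omega>. affine p q i \<omega> * affine r s i \<omega>)"
    unfolding eq using int by (simp del: of_real_power)
  show "expectation (\<lambda>\<omega>. affine p q i \<omega> * affine r s i \<omega>) = p * r + q * s"
    unfolding eq using assms sq int unfolding standardized_def
    by (simp add: prob_space del: of_real_power)
qed

lemma cnj_affine: "cnj (affine p q i \<omega>) = affine (cnj p) (cnj q) i \<omega>"
  by simp

lemma msq_affine:
  assumes "standardized i" shows "msq (affine p q i) = (cmod p)\<^sup>2 + (cmod q)\<^sup>2"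
proof -
  have "complex_of_real (msq (affine p q i)) = expectation (\<lambda>\<omega>. complex_of_real ((cmod (affine p q i \<omega>))\<^sup>2))"
    unfolding integral_complex_of_real ..
  also have "\<dots> = expectation (\<lambda>\<omega>. affine p q i \<omega> * affine (cnj p) (cnj q) i \<omega>)"
    unfolding complex_norm_square cnj_affine ..
  also have "\<dots> = complex_of_real ((cmod p)\<^sup>2 + (cmod q)\<^sup>2)"
    unfolding expectation_affine_mult_affine(2)[OF assms] of_real_add complex_norm_square ..
  finally show ?thesis by (simp only: of_real_eq_iff)
qed

lemma affine_measurable: "affine p q i \<in> borel_measurable (info {i})"
proof -
  have [measurable]: "X i \<in> borel_measurable (info {i})" by (rule measurable_info_component) simp
  show ?thesis by measurable
qed

text \<open>The variables \<open>X i\<close> and \<open>X j\<close> stand for the increments of the first and second fine step of one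
coarse interval: \<open>two_step\<close> is the fine propagator, \<open>one_step\<close> the coarse one, with
\<open>s = B / sqrt 2\<close> because the normalized coarse increment is the sum of the two normalized fine ones
divided by \<open>sqrt 2\<close>.\<close>
context
  fixes i j :: 'i
  assumes i: "standardized i" and j: "standardized j" and ij: "i \<noteq> j"
begin

abbreviation one_step where "one_step A s \<equiv> \<lambda>\<omega>. A + s * complex_of_real (X i \<omega> + X j \<omega>)"
abbreviation two_step where "two_step a b \<equiv> \<lambda>\<omega>. affine a b j \<omega> * affine a b i \<omega>"

lemma
  shows L2_two_step: "L2 {i, j} (two_step a b)"
    and msq_two_step: "msq (two_step a b) = ((cmod a)\<^sup>2 + (cmod b)\<^sup>2)\<^sup>2"
proof -
  note mult = L2_mult[OF L2_affine[OF j, of a b] L2_affine[OF i, of a b]]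
  show "L2 {i, j} (two_step a b)" using mult(1) ij by (simp add: insert_commute)
  show "msq (two_step a b) = ((cmod a)\<^sup>2 + (cmod b)\<^sup>2)\<^sup>2"
    using mult(2) ij unfolding msq_affine[OF i] msq_affine[OF j]
    by (simp add: power2_eq_square[of "(cmod a)\<^sup>2 + (cmod b)\<^sup>2"])
qed

lemma expectation_mult_pair:
  assumes f: "f \<in> borel_measurable (info {i})" "integrable M f"
    and g: "g \<in> borel_measurable (info {j})" "integrable M g"
  shows "integrable M (\<lambda>\<omega>. f \<omega> * g \<omega>)"
    and "expectation (\<lambda>\<omega>. f \<omega> * g \<omega>) = expectation f * (expectation g :: complex)"
  using integral_mult_info[OF f(1) g(1) _ _ _ f(2) g(2)] ij i j unfolding standardized_def by auto

lemma L2_one_step: "L2 {i, j} (one_step A s)"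
proof -
  have "L2 {i, j} (\<lambda>\<omega>. affine A s i \<omega> + affine 0 s j \<omega>)"
    using i j by (intro L2_add(1) L2_mono[OF L2_affine]) (auto simp: standardized_def)
  then show ?thesis by (simp add: algebra_simps)
qed

text \<open>Splitting \<open>one_step A s\<close> into its part in \<open>X i\<close> and the remainder \<open>s * X j\<close> writes the integrand
as two products of a function of \<open>X i\<close> and a function of \<open>X j\<close>, so moments above the second are
avoided.\<close>
lemma expectation_one_step_mult:
  assumes f: "f \<in> borel_measurable (info {i})" "integrable M f"
    and fa: "integrable M (\<lambda>\<omega>. affine A s i \<omega> * f \<omega>)"
  shows "expectation (\<lambda>\<omega>. one_step A s \<omega> * (affine r t j \<omega> * f \<omega>))
    = expectation (\<lambda>\<omega>. affine A s i \<omega> * f \<omega>) * r + expectation f * (s * t)"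
proof -
  have eq: "(\<lambda>\<omega>. one_step A s \<omega> * (affine r t j \<omega> * f \<omega>))
    = (\<lambda>\<omega>. (affine A s i \<omega> * f \<omega>) * affine r t j \<omega> + f \<omega> * (affine 0 s j \<omega> * affine r t j \<omega>))"
    by (simp add: fun_eq_iff algebra_simps)
  note m1 = expectation_mult_pair[OF borel_measurable_times[OF affine_measurable f(1)] fa
      affine_measurable expectation_affine(1)[OF j]]
  note m2 = expectation_mult_pair[OF f borel_measurable_times[OF affine_measurable affine_measurable]
      expectation_affine_mult_affine(1)[OF j]]
  show ?thesis unfolding eq
    by (simp only: Bochner_Integration.integral_add[OF m1(1) m2(1)] m1(2) m2(2)
        expectation_affine_mult_affine(2)[OF j] expectation_affine(2)[OF j]) simp
qed

lemma expectation_one_step_two_step: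
  "expectation (\<lambda>\<omega>. one_step A s \<omega> * cnj (two_step a b \<omega>)) = A * (cnj a)\<^sup>2 + 2 * s * cnj (a * b)"
  using expectation_one_step_mult[OF affine_measurable expectation_affine(1)[OF i]
      expectation_affine_mult_affine(1)[OF i], of A s "cnj a" "cnj b" "cnj a" "cnj b"]
  unfolding complex_cnj_mult cnj_affine expectation_affine_mult_affine(2)[OF i] expectation_affine(2)[OF i]
  by (simp add: power2_eq_square algebra_simps)

lemma msq_one_step: "msq (one_step A s) = (cmod A)\<^sup>2 + 2 * (cmod s)\<^sup>2"
proof -
  have "L2 {i} (affine A s i)" "L2 {j} (affine 0 s j)" using i j by (simp_all only: L2_affine)
  note L2 = L2_mono[OF this(1), of "{i, j}"] L2_mono[OF this(2), of "{i, j}"]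
  have ij': "{i, j} \<subseteq> I" using i j unfolding standardized_def by simp
  note cross = expectation_mult_pair[OF affine_measurable expectation_affine(1)[OF i]
      affine_measurable expectation_affine(1)[OF j], of A s 0 "cnj s"]
  have "msq (one_step A s) = msq (\<lambda>\<omega>. affine A s i \<omega> + affine 0 s j \<omega>)"
    by (simp add: algebra_simps)
  also have "\<dots> = msq (affine A s i) + msq (affine 0 s j)
      + 2 * Re (expectation (\<lambda>\<omega>. affine A s i \<omega> * affine 0 (cnj s) j \<omega>))"
    by (subst msq_add[OF L2(1)[OF _ ij'] L2(2)[OF _ ij']]) (simp_all add: cnj_affine)
  also have "\<dots> = (cmod A)\<^sup>2 + 2 * (cmod s)\<^sup>2"
    unfolding cross(2) msq_affine[OF i] msq_affine[OF j] expectation_affine(2)[OF i] expectation_affine(2)[OF j]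
    by simp
  finally show ?thesis .
qed

end

lemma moments_diff:
  assumes f: "L2 A f" and g: "L2 A g"
  shows "msq (\<lambda>\<omega>. f \<omega> - g \<omega>) = msq f + msq g - 2 * Re (expectation (\<lambda>\<omega>. g \<omega> * cnj (f \<omega>)))"
    and "expectation (\<lambda>\<omega>. g \<omega> * cnj (f \<omega> - g \<omega>)) = expectation (\<lambda>\<omega>. g \<omega> * cnj (f \<omega>)) - complex_of_real (msq g)"
proof -
  note gf = L2_inner(1)[OF g f]
  have "msq (\<lambda>\<omega>. f \<omega> - g \<omega>) = msq (\<lambda>\<omega>. g \<omega> + - f \<omega>)" by (simp add: norm_minus_commute)
  also have "\<dots> = msq f + msq g - 2 * Re (expectation (\<lambda>\<omega>. g \<omega> * cnj (f \<omega>)))"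
    unfolding msq_add[OF g L2_uminus[OF f]] by simp
  finally show "msq (\<lambda>\<omega>. f \<omega> - g \<omega>) = msq f + msq g - 2 * Re (expectation (\<lambda>\<omega>. g \<omega> * cnj (f \<omega>)))" .
  have "(\<lambda>\<omega>. g \<omega> * cnj (f \<omega> - g \<omega>)) = (\<lambda>\<omega>. g \<omega> * cnj (f \<omega>) - complex_of_real ((cmod (g \<omega>))\<^sup>2))"
    unfolding complex_norm_square by (simp add: algebra_simps)
  then show "expectation (\<lambda>\<omega>. g \<omega> * cnj (f \<omega> - g \<omega>))
      = expectation (\<lambda>\<omega>. g \<omega> * cnj (f \<omega>)) - complex_of_real (msq g)"
    using gf L2_D(4)[OF g] by (simp del: of_real_power)
qed

end

section \<open>Error recursions of the scheme\<close>

text \<open>Indices of the noise seen up to time index \<open>n\<close>: \<open>Inl i\<close> is the increment of the \<open>i\<close>-th fine step, and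
\<open>Inr (k, m)\<close> is the sampling variable of iteration \<open>k\<close> at time index \<open>m\<close>. All iterations are
included, because every \<open>U k n\<close> depends only on noise that precedes \<open>n\<close> in time.\<close>
definition noise_index :: "nat \<Rightarrow> (nat + nat \<times> nat) set" where
  "noise_index n = {..<2 * n} <+> ({1..} \<times> {1..<n})"

text \<open>As \<open>noise_index n\<close>, with the sampling variables at time index \<open>n\<close> itself added; \<open>alph k n\<close> depends
on these, and they precede the Wiener increments of the next coarse interval.\<close>
definition sampled_index :: "nat \<Rightarrow> (nat + nat \<times> nat) set" where
  "sampled_index n = {..<2 * n} <+> ({1..} \<times> {1..<Suc n})"

text \<open>The scheme driven by an abstract independent family with standardized increments. The variable
\<open>\<zeta> k n\<close> is the normalized sample, which makes the two sampling rules instances of one formula.\<close>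
locale sparareal =
  independent_family M X "noise_index N"
  for M :: "'w measure" and N :: nat and X :: "nat + nat \<times> nat \<Rightarrow> 'w \<Rightarrow> real" +
  fixes a b A B u0 :: complex
    and F G u :: "nat \<Rightarrow> 'w \<Rightarrow> complex"
    and U alph :: "nat \<Rightarrow> nat \<Rightarrow> 'w \<Rightarrow> complex"
    and \<zeta> :: "nat \<Rightarrow> nat \<Rightarrow> 'w \<Rightarrow> real"
    and \<alpha> \<beta> \<gamma> \<kappa> :: real
  assumes standard: "i < 2 * N \<Longrightarrow> standardized (Inl i)"
    and F: "F n = (\<lambda>\<omega>. (a + b * complex_of_real (X (Inl (Suc (2 * n))) \<omega>))
        * (a + b * complex_of_real (X (Inl (2 * n)) \<omega>)))"
    and G: "G n = (\<lambda>\<omega>. A + B / sqrt 2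
        * complex_of_real (X (Inl (2 * n)) \<omega> + X (Inl (Suc (2 * n))) \<omega>))"
    and fine: "fine_solution M N u0 F u"
    and scheme: "sparareal_scheme M N u0 F G U alph"
    and sample_info: "1 \<le> k \<Longrightarrow> n \<in> {1..<N} \<Longrightarrow> \<zeta> k n \<in> borel_measurable (info {Inr (k, n)})"
    and sample_integrable: "1 \<le> k \<Longrightarrow> n \<in> {1..<N} \<Longrightarrow> integrable M (\<lambda>\<omega>. (\<zeta> k n \<omega>)\<^sup>2)"
    and sample_square: "1 \<le> k \<Longrightarrow> n \<in> {1..<N} \<Longrightarrow> expectation (\<lambda>\<omega>. (\<zeta> k n \<omega>)\<^sup>2) = 1"
    and rule: "1 \<le> k \<Longrightarrow> n \<in> {1..<N} \<Longrightarrow> \<omega> \<in> space M \<Longrightarrow>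
      alph k n \<omega> = F (n - 1) \<omega> * U (k - 1) (n - 1) \<omega>
        + complex_of_real (sparareal_sigma G U k n \<omega> * \<zeta> k n \<omega>)"
    and \<gamma>: "\<gamma> = (cmod A)\<^sup>2 + (cmod B)\<^sup>2"
    and \<kappa>: "\<kappa> = ((cmod a)\<^sup>2 + (cmod b)\<^sup>2)\<^sup>2"
    and \<alpha>: "\<alpha> = (cmod A)\<^sup>2 + (cmod B)\<^sup>2
        + cmod (A * (cnj a)\<^sup>2 - (cmod B)\<^sup>2 - (cmod A)\<^sup>2 + sqrt 2 * B * cnj (a * b))"
    and \<beta>: "\<beta> = - 2 * Re (cnj A * a\<^sup>2) + (cmod A)\<^sup>2 + (cmod B)\<^sup>2
        - 2 * sqrt 2 * Re (cnj B * a * b) + ((cmod a)\<^sup>2 + (cmod b)\<^sup>2)\<^sup>2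
        + cmod (A * (cnj a)\<^sup>2 - (cmod B)\<^sup>2 - (cmod A)\<^sup>2 + sqrt 2 * B * cnj (a * b))"
begin

abbreviation "noise n \<equiv> {Inl (2 * n), Inl (Suc (2 * n))} :: (nat + nat \<times> nat) set"
abbreviation "D n \<equiv> \<lambda>\<omega>. F n \<omega> - G n \<omega>"

lemma index_sets:
  "n < N \<Longrightarrow> noise n \<union> noise_index n \<subseteq> noise_index (Suc n)"
  "n < N \<Longrightarrow> noise n \<union> sampled_index n \<subseteq> noise_index (Suc n)"
  "noise_index n \<subseteq> sampled_index n"
  "noise n \<inter> noise_index n = {}" "noise n \<inter> sampled_index n = {}"
  "n \<le> N \<Longrightarrow> noise_index n \<subseteq> noise_index N"
  "n < N \<Longrightarrow> sampled_index n \<subseteq> noise_index N"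
  by (auto simp: noise_index_def sampled_index_def)

context
  fixes n assumes n: "n < N"
begin

lemma std: "standardized (Inl (2 * n))" "standardized (Inl (Suc (2 * n)))"
  using n by (auto intro!: standard)

lemma noise_moments:
  shows L2_F: "L2 (noise n) (F n)" and L2_G: "L2 (noise n) (G n)"
    and msq_F: "msq (F n) = \<kappa>" and msq_G: "msq (G n) = \<gamma>"
    and cross_moment: "expectation (\<lambda>\<omega>. G n \<omega> * cnj (F n \<omega>)) = A * (cnj a)\<^sup>2 + sqrt 2 * B * cnj (a * b)"
proof -
  show "L2 (noise n) (F n)" unfolding F by (rule L2_two_step[OF std]) simp
  show "L2 (noise n) (G n)" unfolding G by (rule L2_one_step[OF std]) simp
  show "msq (F n) = \<kappa>" unfolding F \<kappa> by (rule msq_two_step[OF std]) simp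
  have "(cmod (B / sqrt 2))\<^sup>2 = (cmod B)\<^sup>2 / 2" by (simp add: norm_divide power_divide)
  then show "msq (G n) = \<gamma>" unfolding G \<gamma> using msq_one_step[OF std, of A "B / sqrt 2"] by simp
  have "2 * (B / sqrt 2) = sqrt 2 * B"
    by (simp add: field_simps flip: of_real_mult)
  then show "expectation (\<lambda>\<omega>. G n \<omega> * cnj (F n \<omega>)) = A * (cnj a)\<^sup>2 + sqrt 2 * B * cnj (a * b)"
    unfolding G F using expectation_one_step_two_step[OF std, of A "B / sqrt 2" a b] by simp
qed

text \<open>The last estimate is what turns \<open>4/3\<close> times the moment of the correction into the coefficients of
the two-step recursion: pointwise \<open>cmod (F - G)^2 \<le> 3/2 * cmod F^2 + 3 * cmod G^2\<close>, again Young's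
inequality with reciprocal weights (\<open>2/3 + 1/3 = 1\<close>).\<close>
lemma correction_moments:
  defines "h \<equiv> cmod (expectation (\<lambda>\<omega>. G n \<omega> * cnj (D n \<omega>)))"
  shows "L2 (noise n) (D n)" and "\<alpha> = msq (G n) + h" and "\<beta> = msq (D n) + h"
    and "4 / 3 * msq (D n) \<le> 2 * \<kappa> + 4 * \<gamma>"
proof -
  show "L2 (noise n) (D n)" by (rule L2_diff(1)[OF L2_F L2_G])
  note diff = moments_diff[OF L2_F L2_G]
  have h: "h = cmod (A * (cnj a)\<^sup>2 - (cmod B)\<^sup>2 - (cmod A)\<^sup>2 + sqrt 2 * B * cnj (a * b))"
    unfolding h_def diff(2) cross_moment msq_G \<gamma> by (simp add: algebra_simps)
  show "\<alpha> = msq (G n) + h" unfolding \<alpha> h msq_G \<gamma> ..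
  have "Re (cnj A * a\<^sup>2) = Re (A * (cnj a)\<^sup>2)" "Re (cnj B * a * b) = Re (B * cnj (a * b))"
    by (simp_all add: power2_eq_square algebra_simps)
  moreover have "Re (sqrt 2 * B * cnj (a * b)) = sqrt 2 * Re (B * cnj (a * b))"
    by (simp add: algebra_simps)
  ultimately show "\<beta> = msq (D n) + h"
    unfolding \<beta> h diff(1) cross_moment msq_F msq_G \<kappa> \<gamma> by simp
  have "(cmod (F n \<omega> - G n \<omega>))\<^sup>2 \<le> 3 / 2 * (cmod (F n \<omega>))\<^sup>2 + 3 * (cmod (G n \<omega>))\<^sup>2" for \<omega>
  proof -
    have "0 \<le> (cmod (F n \<omega> + 2 * G n \<omega>))\<^sup>2" by simp
    also have "\<dots> = (cmod (F n \<omega>))\<^sup>2 + 4 * (cmod (G n \<omega>))\<^sup>2 + 4 * Re (F n \<omega> * cnj (G n \<omega>))"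
      unfolding norm_add_square by (simp add: norm_mult power_mult_distrib)
    finally show ?thesis unfolding norm_diff_square by linarith
  qed
  then have "msq (D n) \<le> expectation (\<lambda>\<omega>. 3 / 2 * (cmod (F n \<omega>))\<^sup>2 + 3 * (cmod (G n \<omega>))\<^sup>2)"
    using L2_D(4)[OF L2_F] L2_D(4)[OF L2_G] L2_D(4)[OF \<open>L2 (noise n) (D n)\<close>]
    by (intro integral_mono) auto
  also have "\<dots> = 3 / 2 * \<kappa> + 3 * \<gamma>"
    using L2_D(4)[OF L2_F] L2_D(4)[OF L2_G] by (simp add: msq_F msq_G)
  finally show "4 / 3 * msq (D n) \<le> 2 * \<kappa> + 4 * \<gamma>" by simp
qed

text \<open>The second bound has the coefficients of the two-step recursion without the factor
\<open>\<beta> / (1 - \<alpha>)\<close>.\<close>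
lemma error_step:
  assumes "L2 (sampled_index n) x" "L2 (sampled_index n) y"
  shows "msq (\<lambda>\<omega>. G n \<omega> * x \<omega> + D n \<omega> * y \<omega>) \<le> \<alpha> * msq x + \<beta> * msq y"
    and "msq (\<lambda>\<omega>. G n \<omega> * x \<omega> + D n \<omega> * y \<omega>) \<le> 4 * \<gamma> * msq x + (2 * \<kappa> + 4 * \<gamma>) * msq y"
proof -
  note lin = random_linear_combination[OF L2_G correction_moments(1) assms index_sets(5)]
  show "msq (\<lambda>\<omega>. G n \<omega> * x \<omega> + D n \<omega> * y \<omega>) \<le> \<alpha> * msq x + \<beta> * msq y"
    using lin(2) unfolding correction_moments(2,3) .
  have "4 / 3 * msq (D n) * msq y \<le> (2 * \<kappa> + 4 * \<gamma>) * msq y"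
    by (intro mult_right_mono correction_moments(4)) simp
  then show "msq (\<lambda>\<omega>. G n \<omega> * x \<omega> + D n \<omega> * y \<omega>) \<le> 4 * \<gamma> * msq x + (2 * \<kappa> + 4 * \<gamma>) * msq y"
    using lin(3) unfolding msq_G by linarith
qed

end

lemma L2_noise_mult:
  assumes "n < N" "L2 (noise n) f" "L2 (noise_index n) x"
  shows "L2 (noise_index (Suc n)) (\<lambda>\<omega>. f \<omega> * x \<omega>)" "msq (\<lambda>\<omega>. f \<omega> * x \<omega>) = msq f * msq x"
  using L2_mult[OF assms(2,3) index_sets(4)] L2_mono index_sets(1,6) assms(1) by auto

lemma sigma_eq:
  "complex_of_real (sparareal_sigma G U k n \<omega>)
    = complex_of_real (cmod (G (n - 1) \<omega> * (U k (n - 1) \<omega> - U (k - 1) (n - 1) \<omega>)))"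
  unfolding sparareal_sigma_def by (simp add: algebra_simps)

lemma L2_norm: "L2 S f \<Longrightarrow> L2 S (\<lambda>\<omega>. complex_of_real (cmod (f \<omega>)))"
  unfolding L2_def by auto

text \<open>The scale \<open>sparareal_sigma\<close> is a function of noise before time index \<open>n\<close> and hence independent of the
sampling variable with indices \<open>(k, n)\<close>; the propagator inside it is in turn independent of the
iterates at time index \<open>n - 1\<close>.\<close>
lemma sigma_sample:
  assumes k: "1 \<le> k" and n: "n \<in> {1..<N}"
    and U: "L2 (noise_index (n - 1)) (U k (n - 1))" "L2 (noise_index (n - 1)) (U (k - 1) (n - 1))"
  shows "L2 (sampled_index n) (\<lambda>\<omega>. complex_of_real (sparareal_sigma G U k n \<omega> * \<zeta> k n \<omega>))"
    and "msq (\<lambda>\<omega>. complex_of_real (sparareal_sigma G U k n \<omega> * \<zeta> k n \<omega>))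
      = \<gamma> * msq (\<lambda>\<omega>. U k (n - 1) \<omega> - U (k - 1) (n - 1) \<omega>)"
proof -
  have n1: "n - 1 < N" "Suc (n - 1) = n" using n by auto
  note sub = L2_diff(1)[OF U]
  note prod = L2_noise_mult[OF n1(1) L2_G[OF n1(1)] sub]
  define s where "s = (\<lambda>\<omega>. complex_of_real (sparareal_sigma G U k n \<omega>))"
  define z where "z = (\<lambda>\<omega>. complex_of_real (\<zeta> k n \<omega>))"
  have s: "L2 (noise_index n) s" "msq s = \<gamma> * msq (\<lambda>\<omega>. U k (n - 1) \<omega> - U (k - 1) (n - 1) \<omega>)"
    unfolding s_def sigma_eq using L2_norm[OF prod(1)] prod(2) msq_G[OF n1(1)] n1 by simp_all
  have idx: "{Inr (k, n)} \<subseteq> noise_index N" using k n by (auto simp: noise_index_def)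
  have z: "L2 {Inr (k, n)} z" "msq z = 1"
    unfolding z_def using L2_of_real[OF idx sample_info[OF k n] sample_integrable[OF k n]]
      sample_square[OF k n] by simp_all
  have disj: "noise_index n \<inter> {Inr (k, n)} = {}" by (auto simp: noise_index_def sampled_index_def)
  have incl: "noise_index n \<union> {Inr (k, n)} \<subseteq> sampled_index n" using k n by (auto simp: noise_index_def sampled_index_def)
  note sz = L2_mult[OF s(1) z(1) disj]
  have eq: "complex_of_real (sparareal_sigma G U k n \<omega> * \<zeta> k n \<omega>) = s \<omega> * z \<omega>" for \<omega>
    by (simp add: s_def z_def)
  show "L2 (sampled_index n) (\<lambda>\<omega>. complex_of_real (sparareal_sigma G U k n \<omega> * \<zeta> k n \<omega>))"
    unfolding eq using L2_mono[OF sz(1) incl] index_sets(7) n by simp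
  show "msq (\<lambda>\<omega>. complex_of_real (sparareal_sigma G U k n \<omega> * \<zeta> k n \<omega>))
      = \<gamma> * msq (\<lambda>\<omega>. U k (n - 1) \<omega> - U (k - 1) (n - 1) \<omega>)"
    unfolding eq sz(2) s(2) z(2) by simp
qed

lemma L2_alph_step:
  assumes n: "n < N" and now: "\<And>k. L2 (noise_index n) (U k n)"
    and before: "\<And>k. 1 \<le> n \<Longrightarrow> L2 (noise_index (n - 1)) (U k (n - 1))"
  shows "L2 (sampled_index n) (alph k n)"
proof -
  consider "k = 0" | "n = 0" | "1 \<le> k" "n \<in> {1..<N}" using n by fastforce
  then show ?thesis
  proof cases
    case 1
    have "L2 (sampled_index n) (U 0 n)"
      by (rule L2_mono[OF now index_sets(3) index_sets(7)[OF n]])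
    then show ?thesis
      by (rule L2_cong[rotated]) (use scheme n 1 in \<open>auto simp: sparareal_scheme_def\<close>)
  next
    case 2
    have "L2 (sampled_index n) (\<lambda>_. u0)" by (rule L2_const[OF index_sets(7)[OF n]])
    then show ?thesis
      by (rule L2_cong[rotated]) (use scheme 2 in \<open>auto simp: sparareal_scheme_def\<close>)
  next
    case 3
    then have n1: "n - 1 < N" "Suc (n - 1) = n" "1 \<le> n" by auto
    have "L2 (noise_index n) (\<lambda>\<omega>. F (n - 1) \<omega> * U (k - 1) (n - 1) \<omega>)"
      using L2_noise_mult(1)[OF n1(1) L2_F[OF n1(1)] before[OF n1(3)]] n1(2) by simp
    from L2_add(1)[OF L2_mono[OF this index_sets(3) index_sets(7)[OF n]]
        sigma_sample(1)[OF 3 before[OF n1(3)] before[OF n1(3)]]]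
    show ?thesis by (rule L2_cong[rotated]) (use rule 3 in auto)
  qed
qed

text \<open>Induction on time for all iterations at once: \<open>U (k+1) (n+1)\<close> needs \<open>alph k n\<close>, and this refers to
iterates two time indices back.\<close>
lemma L2_iterates: "n \<le> N \<Longrightarrow> L2 (noise_index n) (U k n)"
proof (induction n arbitrary: k rule: less_induct)
  case (less n)
  show ?case
  proof (cases n)
    case 0
    have "L2 (noise_index n) (\<lambda>_. u0)" by (rule L2_const[OF index_sets(6)[OF less.prems]])
    then show ?thesis
      by (rule L2_cong[rotated]) (use scheme 0 in \<open>auto simp: sparareal_scheme_def\<close>)
  next
    case (Suc m)
    then have m: "m < N" using less.prems by simp
    have now: "L2 (noise_index m) (U j m)" for j using less Suc by simp
    have before: "L2 (noise_index (m - 1)) (U j (m - 1))" for j using less Suc by simp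
    show ?thesis
    proof (cases k)
      case 0
      show ?thesis unfolding Suc
        by (rule L2_cong[OF _ L2_noise_mult(1)[OF m L2_G[OF m] now[of 0]]])
          (use scheme m 0 in \<open>auto simp: sparareal_scheme_def\<close>)
    next
      case (Suc j)
      have "L2 (sampled_index m) (alph j m)" by (rule L2_alph_step[OF m now before])
      note lin = random_linear_combination(1)[OF L2_G[OF m] correction_moments(1)[OF m]
          L2_mono[OF now index_sets(3) index_sets(7)[OF m]] this index_sets(5)]
      have "Suc m \<le> N" using m by simp
      show ?thesis unfolding Suc \<open>n = Suc m\<close>
        by (rule L2_cong[OF _ L2_mono[OF lin index_sets(2)[OF m] index_sets(6)[OF \<open>Suc m \<le> N\<close>]]])
          (use scheme m in \<open>auto simp: sparareal_scheme_def\<close>)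
    qed
  qed
qed

lemma L2_alph: "n < N \<Longrightarrow> L2 (sampled_index n) (alph k n)"
  by (rule L2_alph_step) (auto intro: L2_iterates)

lemma L2_fine: "n \<le> N \<Longrightarrow> L2 (noise_index n) (u n)"
proof (induction n)
  case 0
  have "L2 (noise_index 0) (\<lambda>_. u0)" by (rule L2_const[OF index_sets(6)[OF 0]])
  then show ?case by (rule L2_cong[rotated]) (use fine in \<open>auto simp: fine_solution_def\<close>)
next
  case (Suc n)
  then have n: "n < N" by simp
  show ?case
    by (rule L2_cong[OF _ L2_noise_mult(1)[OF n L2_F[OF n] Suc.IH]])
      (use fine n in \<open>auto simp: fine_solution_def\<close>)
qed

abbreviation "\<epsilon> k n \<equiv> mean_square_error M u U k n"
abbreviation "E k \<equiv> sup_error M N u U k"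

lemma error_recursion:
  assumes n: "n < N"
  shows "\<epsilon> (Suc k) (Suc n) \<le> \<alpha> * \<epsilon> (Suc k) n + \<beta> * msq (\<lambda>\<omega>. alph k n \<omega> - u n \<omega>)"
    and "\<epsilon> (Suc k) (Suc n) \<le> 4 * \<gamma> * \<epsilon> (Suc k) n + (2 * \<kappa> + 4 * \<gamma>) * msq (\<lambda>\<omega>. alph k n \<omega> - u n \<omega>)"
proof -
  have eq: "\<epsilon> (Suc k) (Suc n)
      = msq (\<lambda>\<omega>. G n \<omega> * (U (Suc k) n \<omega> - u n \<omega>) + D n \<omega> * (alph k n \<omega> - u n \<omega>))"
    unfolding mean_square_error_def using scheme fine n
    by (intro msq_cong) (auto simp: sparareal_scheme_def fine_solution_def algebra_simps)
  have up: "L2 (noise_index n) f \<Longrightarrow> L2 (sampled_index n) f" for f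
    using L2_mono index_sets(3,7) n by blast
  have "L2 (sampled_index n) (\<lambda>\<omega>. U (Suc k) n \<omega> - u n \<omega>)"
    "L2 (sampled_index n) (\<lambda>\<omega>. alph k n \<omega> - u n \<omega>)"
    using n by (simp_all add: L2_diff(1) up L2_iterates L2_fine L2_alph)
  from error_step[OF n this]
  show "\<epsilon> (Suc k) (Suc n) \<le> \<alpha> * \<epsilon> (Suc k) n + \<beta> * msq (\<lambda>\<omega>. alph k n \<omega> - u n \<omega>)"
    and "\<epsilon> (Suc k) (Suc n) \<le> 4 * \<gamma> * \<epsilon> (Suc k) n + (2 * \<kappa> + 4 * \<gamma>) * msq (\<lambda>\<omega>. alph k n \<omega> - u n \<omega>)"
    unfolding eq by (simp_all only: mean_square_error_def)
qed

lemma error_nonneg: "0 \<le> \<epsilon> k n"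
  unfolding mean_square_error_def by simp

lemma error_le_sup: "n \<le> N \<Longrightarrow> \<epsilon> k n \<le> E k"
  unfolding sup_error_def by (rule cSUP_upper) auto

lemma sup_error_nonneg: "0 \<le> E k"
  using error_nonneg[of k 0] error_le_sup[of 0 k] by simp

lemma coefficients_nonneg: "0 \<le> \<gamma>" "0 \<le> \<kappa>" "0 \<le> \<alpha>"
  unfolding \<gamma> \<kappa> \<alpha> by simp_all

text \<open>The error vanishes at time index \<open>0\<close>, and every later one is estimated through its predecessor,
which is again at most the supremum.\<close>
lemma sup_error_recursion:
  assumes step: "\<And>n. n < N \<Longrightarrow>
      \<epsilon> (Suc k) (Suc n) \<le> r * \<epsilon> (Suc k) n + s * msq (\<lambda>\<omega>. alph k n \<omega> - u n \<omega>)"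
    and c: "\<And>n. n < N \<Longrightarrow> msq (\<lambda>\<omega>. alph k n \<omega> - u n \<omega>) \<le> c" "0 \<le> c"
    and r: "0 \<le> r" and s: "0 \<le> s"
  shows "E (Suc k) \<le> r * E (Suc k) + s * c"
proof -
  have "\<epsilon> (Suc k) n \<le> r * E (Suc k) + s * c" if "n \<le> N" for n
  proof (cases n)
    case 0
    have "\<epsilon> (Suc k) 0 = msq (\<lambda>_. 0)"
      unfolding mean_square_error_def using scheme fine
      by (intro msq_cong) (auto simp: sparareal_scheme_def fine_solution_def)
    then show ?thesis using 0 r s c(2) sup_error_nonneg[of "Suc k"] by simp
  next
    case (Suc m)
    then have m: "m < N" using that by simp
    have "r * \<epsilon> (Suc k) m \<le> r * E (Suc k)"
      using m by (intro mult_left_mono error_le_sup r) simp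
    moreover have "s * msq (\<lambda>\<omega>. alph k m \<omega> - u m \<omega>) \<le> s * c"
      by (intro mult_left_mono c(1) m s)
    ultimately show ?thesis using step[OF m] Suc by simp
  qed
  then show ?thesis unfolding sup_error_def[of M N u U "Suc k"] by (intro cSUP_least) auto
qed

lemma first_sampling_error: "n < N \<Longrightarrow> msq (\<lambda>\<omega>. alph 0 n \<omega> - u n \<omega>) \<le> E 0"
proof -
  assume n: "n < N"
  have "msq (\<lambda>\<omega>. alph 0 n \<omega> - u n \<omega>) = \<epsilon> 0 n"
    unfolding mean_square_error_def using scheme n
    by (intro msq_cong) (auto simp: sparareal_scheme_def)
  then show ?thesis using error_le_sup[of n 0] n by simp
qed

text \<open>The error of the sampled value is \<open>F (n-1) * e k (n-1)\<close> plus the sampled term, and the scale of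
the latter is \<open>G (n-1)\<close> times a difference of errors of successive iterations. Both sums are split by
\<open>cmod (x + y)^2 \<le> 2 * cmod x^2 + 2 * cmod y^2\<close>. At time index \<open>0\<close> there is no sampling and no error.\<close>
lemma sampling_error:
  assumes n: "n < N"
  shows "msq (\<lambda>\<omega>. alph (Suc k) n \<omega> - u n \<omega>) \<le> (2 * \<kappa> + 4 * \<gamma>) * E k + 4 * \<gamma> * E (Suc k)"
proof (cases n)
  case 0
  have "msq (\<lambda>\<omega>. alph (Suc k) n \<omega> - u n \<omega>) = msq (\<lambda>_. 0)"
    using scheme fine 0
    by (intro msq_cong) (auto simp: sparareal_scheme_def fine_solution_def)
  then show ?thesis using coefficients_nonneg sup_error_nonneg by simp
next
  case (Suc m)
  then have m: "m < N" "m \<le> N" using n by auto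
  have k: "1 \<le> Suc k" "n \<in> {1..<N}" using Suc n by auto
  define e where "e j = (\<lambda>\<omega>. U j m \<omega> - u m \<omega>)" for j
  have e: "L2 (noise_index m) (e j)" "msq (e j) \<le> E j" for j
    unfolding e_def using m L2_iterates L2_fine error_le_sup[of m j]
    by (auto intro!: L2_diff(1) simp: mean_square_error_def)
  define w where "w = (\<lambda>\<omega>. complex_of_real (sparareal_sigma G U (Suc k) n \<omega> * \<zeta> (Suc k) n \<omega>))"
  have w: "L2 (sampled_index n) w" "msq w = \<gamma> * msq (\<lambda>\<omega>. e (Suc k) \<omega> - e k \<omega>)"
    unfolding w_def e_def using sigma_sample[OF k] Suc m L2_iterates by simp_all
  have Fe: "L2 (sampled_index n) (\<lambda>\<omega>. F m \<omega> * e k \<omega>)" "msq (\<lambda>\<omega>. F m \<omega> * e k \<omega>) = \<kappa> * msq (e k)"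
    using L2_noise_mult[OF m(1) L2_F[OF m(1)] e(1)] msq_F[OF m(1)] Suc
      L2_mono[OF _ index_sets(3) index_sets(7)[OF n]] by auto
  have "msq (\<lambda>\<omega>. alph (Suc k) n \<omega> - u n \<omega>) = msq (\<lambda>\<omega>. F m \<omega> * e k \<omega> + w \<omega>)"
  proof (rule msq_cong)
    fix \<omega> assume "\<omega> \<in> space M"
    then show "alph (Suc k) n \<omega> - u n \<omega> = F m \<omega> * e k \<omega> + w \<omega>"
      using rule[OF k] fine m Suc by (simp add: fine_solution_def e_def w_def algebra_simps)
  qed
  also have "\<dots> \<le> 2 * (\<kappa> * msq (e k)) + 2 * (\<gamma> * msq (\<lambda>\<omega>. e (Suc k) \<omega> - e k \<omega>))"
    using L2_add(2)[OF Fe(1) w(1)] unfolding Fe(2) w(2) .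
  also have "\<dots> \<le> 2 * (\<kappa> * msq (e k)) + 2 * (\<gamma> * (2 * msq (e (Suc k)) + 2 * msq (e k)))"
    using L2_diff(2)[OF e(1) e(1)] coefficients_nonneg by (intro add_left_mono mult_left_mono) auto
  also have "\<dots> \<le> 2 * (\<kappa> * E k) + 2 * (\<gamma> * (2 * E (Suc k) + 2 * E k))"
    using e(2) coefficients_nonneg by (intro add_mono mult_left_mono) auto
  finally show ?thesis by (simp add: algebra_simps)
qed

text \<open>Absorbing the term \<open>\<alpha> * E (k+2)\<close> on the left gives the two-step recursion. The quadratic start is
the product of the two bounds on \<open>E 1\<close>, with \<open>E 1 \<le> 4 * \<gamma> * E 1 + (2 * \<kappa> + 4 * \<gamma>) * E 0\<close> left
unsolved for \<open>E 1\<close>.\<close>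
lemma sup_error_bound:
  assumes N: "0 < N" and less: "\<alpha> < 1"
  shows "E k \<le> E 0 *
    ((4 * \<beta> * \<gamma> / (1 - \<alpha>)
      + sqrt ((4 * \<beta> * \<gamma> / (1 - \<alpha>))\<^sup>2 + 4 * ((2 * \<beta> * \<kappa> + 4 * \<beta> * \<gamma>) / (1 - \<alpha>)))) / 2) ^ k"
proof (rule two_step_recursion_bound)
  note nn = coefficients_nonneg sup_error_nonneg
  have \<beta>0: "0 \<le> \<beta>" unfolding correction_moments(3)[OF N] by simp
  show "0 \<le> E j" for j by (rule sup_error_nonneg)
  show "0 \<le> 4 * \<beta> * \<gamma> / (1 - \<alpha>)" "0 \<le> (2 * \<beta> * \<kappa> + 4 * \<beta> * \<gamma>) / (1 - \<alpha>)"
    using nn \<beta>0 less by simp_all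
  show "E (Suc (Suc j)) \<le> 4 * \<beta> * \<gamma> / (1 - \<alpha>) * E (Suc j) + (2 * \<beta> * \<kappa> + 4 * \<beta> * \<gamma>) / (1 - \<alpha>) * E j" for j
  proof -
    let ?c = "(2 * \<kappa> + 4 * \<gamma>) * E j + 4 * \<gamma> * E (Suc j)"
    have "E (Suc (Suc j)) \<le> \<alpha> * E (Suc (Suc j)) + \<beta> * ?c"
      by (rule sup_error_recursion[OF error_recursion(1) sampling_error]) (use nn \<beta>0 in auto)
    then have "E (Suc (Suc j)) \<le> \<beta> * ?c / (1 - \<alpha>)"
      using less by (simp add: field_simps)
    then show ?thesis by (simp add: algebra_simps add_divide_distrib)
  qed
  have "E (Suc 0) \<le> \<alpha> * E (Suc 0) + \<beta> * E 0"
    by (rule sup_error_recursion[OF error_recursion(1) first_sampling_error]) (use nn \<beta>0 in auto)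
  then have crude: "E 1 \<le> \<beta> / (1 - \<alpha>) * E 0" using less by (simp add: field_simps)
  \<comment> \<open>The same step with the weighted estimate.\<close>
  have "E (Suc 0) \<le> 4 * \<gamma> * E (Suc 0) + (2 * \<kappa> + 4 * \<gamma>) * E 0"
    by (rule sup_error_recursion[OF error_recursion(2) first_sampling_error]) (use nn in auto)
  then have "E 1 * E 1 \<le> \<beta> / (1 - \<alpha>) * E 0 * (4 * \<gamma> * E 1 + (2 * \<kappa> + 4 * \<gamma>) * E 0)"
    using crude nn \<beta>0 less by (intro mult_mono) auto
  then show "(E 1)\<^sup>2 \<le> 4 * \<beta> * \<gamma> / (1 - \<alpha>) * E 1 * E 0 + (2 * \<beta> * \<kappa> + 4 * \<beta> * \<gamma>) / (1 - \<alpha>) * (E 0)\<^sup>2"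
    by (simp add: power2_eq_square algebra_simps add_divide_distrib)
qed

end

section \<open>Noise from the Wiener process and the sampling variables\<close>

lemma (in prob_space) centred_normal_moments:
  assumes \<sigma>: "0 < \<sigma>" and D: "distributed M lborel Y (normal_density 0 \<sigma>)"
  shows "integrable M Y" "integrable M (\<lambda>\<omega>. (Y \<omega>)\<^sup>2)"
    and "expectation Y = 0" "expectation (\<lambda>\<omega>. (Y \<omega>)\<^sup>2) = \<sigma>\<^sup>2"
proof -
  note int = distributed_integrable[OF D, symmetric]
  show "integrable M Y"
    using int[of "\<lambda>x. x"] integrable_normal_moment_nz_1[OF \<sigma>, of 0] by simp
  show "integrable M (\<lambda>\<omega>. (Y \<omega>)\<^sup>2)"
    using int[of "\<lambda>x. x\<^sup>2"] integrable_normal_moment[OF \<sigma>, of 0 2] by simp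
  show E: "expectation Y = 0" by (rule normal_distributed_expectation[OF \<sigma> D])
  show "expectation (\<lambda>\<omega>. (Y \<omega>)\<^sup>2) = \<sigma>\<^sup>2"
    using normal_distributed_variance[OF \<sigma> D] unfolding E by simp
qed

text \<open>A uniform variable on the unit interval has mean \<open>1/2\<close> and variance \<open>1/12\<close>; the factor \<open>sqrt 3\<close> is
what normalizes \<open>2 * w - 1\<close>.\<close>
lemma (in prob_space) rescaled_uniform_square:
  assumes D: "distributed M lborel w (\<lambda>x. indicator {0..1} x)"
  shows "integrable M (\<lambda>\<omega>. (sqrt 3 * (2 * w \<omega> - 1))\<^sup>2)"
    and "expectation (\<lambda>\<omega>. (sqrt 3 * (2 * w \<omega> - 1))\<^sup>2) = 1"
proof -
  have D': "distributed M lborel w (\<lambda>x. ennreal (indicator {0..1} x))"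
    using D by (simp add: ennreal_indicator)
  have D'': "distributed M lborel w (\<lambda>x. ennreal (indicator {0..1} x / measure lborel {0..1::real}))"
    using D' by simp
  have "integrable lborel (\<lambda>x. indicator {0..1} x * (sqrt 3 * (2 * x - 1))\<^sup>2 :: real)"
    using borel_integrable_atLeastAtMost[of 0 1 "\<lambda>x::real. (sqrt 3 * (2 * x - 1))\<^sup>2"]
    by (auto simp: mult.commute indicator_times_eq_if intro!: continuous_intros)
  then show "integrable M (\<lambda>\<omega>. (sqrt 3 * (2 * w \<omega> - 1))\<^sup>2)"
    using distributed_integrable[OF D', of "\<lambda>x. (sqrt 3 * (2 * x - 1))\<^sup>2"] by simp
  have "(\<lambda>\<omega>. (sqrt 3 * (2 * w \<omega> - 1))\<^sup>2) = (\<lambda>\<omega>. 12 * (w \<omega> - expectation w)\<^sup>2)"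
    unfolding uniform_distributed_expectation[OF D'']
    by (simp add: fun_eq_iff power_mult_distrib) (simp add: power2_eq_square algebra_simps)
  then show "expectation (\<lambda>\<omega>. (sqrt 3 * (2 * w \<omega> - 1))\<^sup>2) = 1"
    using uniform_distributed_variance[OF D''] by simp
qed

text \<open>The \<open>i\<close>-th fine step, of length \<open>h\<close>, starts at \<open>i * h\<close>, so \<open>Inl (2 * n)\<close> and \<open>Inl (Suc (2 * n))\<close>
are the two increments inside the \<open>n\<close>-th coarse interval.\<close>
definition noise_family ::
  "(real \<Rightarrow> 'w \<Rightarrow> real) \<Rightarrow> (nat \<Rightarrow> nat \<Rightarrow> 'w \<Rightarrow> real) \<Rightarrow> real \<Rightarrow> nat + nat \<times> nat \<Rightarrow> 'w \<Rightarrow> real" where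
  "noise_family W \<xi> h = case_sum (\<lambda>i. normalized_incr W h (real i * h)) (\<lambda>(k, n). \<xi> k n)"

lemma grid_point:
  fixes h :: real
  assumes "0 < h" "T = 2 * real N * h" "i \<le> 2 * N"
  shows "0 \<le> real i * h" "real i * h \<le> T"
proof -
  have "real i \<le> 2 * real N" using assms(3) by linarith
  then show "real i * h \<le> T" using assms(1,2) by simp
qed (use assms in simp)

lemma (in prob_space) independent_family_noise:
  assumes wiener: "wiener_process M T W" and h: "0 < h" "T = 2 * real N * h"
    and samples: "sampling_variables M T W N f \<xi>"
  shows "independent_family M (noise_family W \<xi> h) (noise_index N)"
proof
  let ?I = "{1..} \<times> {1..<N} :: (nat \<times> nat) set"
  let ?SW = "vimage_algebra (space M) (\<lambda>\<omega>. \<lambda>t\<in>{0..T}. W t \<omega>) (PiM {0..T} (\<lambda>_. borel))"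
  let ?S\<xi> = "vimage_algebra (space M) (\<lambda>\<omega>. \<lambda>(k, n)\<in>?I. \<xi> k n \<omega>) (PiM ?I (\<lambda>_. borel))"
  have in_range: "real i * h \<in> {0..T}" if "i \<le> 2 * N" for i
    using grid_point[OF h that] by simp
  have next_point: "real i * h + h = real (Suc i) * h" for i by (simp add: algebra_simps)
  show "indep_vars (\<lambda>_. borel) (noise_family W \<xi> h) (noise_index N)"
    unfolding noise_family_def noise_index_def
  proof (rule indep_vars_Plus[where SX = ?SW and SY = ?S\<xi>])
    have grid: "(\<forall>i\<le>2 * N. real i * h \<in> {0..T}) \<and> (\<forall>i<2 * N. real i * h < real (Suc i) * h)"
      using in_range h(1) by simp
    have "\<forall>(m::nat) \<tau>. (\<forall>i\<le>m. \<tau> i \<in> {0..T}) \<and> (\<forall>i<m. \<tau> i < \<tau> (Suc i)) \<longrightarrow>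
        indep_vars (\<lambda>_. borel) (\<lambda>i \<omega>. W (\<tau> (Suc i)) \<omega> - W (\<tau> i) \<omega>) {..<m}"
      using wiener unfolding wiener_process_def by blast
    from this[rule_format, of "2 * N" "\<lambda>i. real i * h", OF grid]
    have "indep_vars (\<lambda>_. borel) (\<lambda>i \<omega>. W (real (Suc i) * h) \<omega> - W (real i * h) \<omega>) {..<2 * N}" .
    from indep_vars_compose2[OF this, of "\<lambda>_ x. x / sqrt h" "\<lambda>_. borel"]
    show "indep_vars (\<lambda>_. borel) (\<lambda>i. normalized_incr W h (real i * h)) {..<2 * N}"
      unfolding normalized_incr_def next_point by simp
    show "indep_vars (\<lambda>_. borel) (\<lambda>(k, n). \<xi> k n) ?I"
      using samples unfolding sampling_variables_def by (simp add: Let_def)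
    have "indep_set (sets ?S\<xi>) (sets ?SW)"
      using samples unfolding sampling_variables_def Let_def by blast
    then show "indep_set (sets ?SW) (sets ?S\<xi>)"
      unfolding indep_sets2_eq by (metis Int_commute mult.commute)
  next
    fix i assume "i \<in> {..<2 * N}"
    then have "W (real i * h) \<in> borel_measurable ?SW" "W (real (Suc i) * h) \<in> borel_measurable ?SW"
      using in_range[of i] in_range[of "Suc i"] by (auto intro!: measurable_vimage_algebra_component simp del: of_nat_Suc)
    then show "normalized_incr W h (real i * h) \<in> borel_measurable ?SW"
      unfolding normalized_incr_def next_point by (simp del: of_nat_Suc)
  next
    fix j assume "j \<in> ?I"
    from measurable_vimage_algebra_component[OF this, of "\<lambda>(k, n). \<xi> k n" "space M"]
    show "(case j of (k, n) \<Rightarrow> \<xi> k n) \<in> borel_measurable ?S\<xi>"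
      by (simp add: case_prod_beta')
  qed simp_all
qed

lemma (in prob_space) normalized_increment_moments:
  assumes wiener: "wiener_process M T W" and h: "0 < h" and t: "0 \<le> t" "t + h \<le> T"
  defines "Y \<equiv> normalized_incr W h t"
  shows "integrable M Y" "integrable M (\<lambda>\<omega>. (Y \<omega>)\<^sup>2)"
    and "expectation Y = 0" "expectation (\<lambda>\<omega>. (Y \<omega>)\<^sup>2) = 1"
proof -
  have increasing: "0 \<le> t \<and> t < t + h \<and> t + h \<le> T" using h t by simp
  have "distributed M lborel (\<lambda>\<omega>. W (t + h) \<omega> - W t \<omega>) (normal_density 0 (sqrt (t + h - t)))"
    using wiener increasing unfolding wiener_process_def by blast
  then have D: "distributed M lborel (\<lambda>\<omega>. W (t + h) \<omega> - W t \<omega>) (normal_density 0 (sqrt h))"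
    by simp
  note m = centred_normal_moments[OF _ D]
  have Y: "Y = (\<lambda>\<omega>. (W (t + h) \<omega> - W t \<omega>) / sqrt h)"
    "(\<lambda>\<omega>. (Y \<omega>)\<^sup>2) = (\<lambda>\<omega>. (W (t + h) \<omega> - W t \<omega>)\<^sup>2 / h)"
    unfolding Y_def normalized_incr_def using h by (auto simp: power_divide)
  show "integrable M Y" "integrable M (\<lambda>\<omega>. (Y \<omega>)\<^sup>2)" "expectation Y = 0"
    "expectation (\<lambda>\<omega>. (Y \<omega>)\<^sup>2) = 1"
    unfolding Y using m h by (simp_all add: power_divide)
qed

lemma fine_factor_noise:
  "fine_factor W (2 * h) h a b n \<omega>
    = (a + b * complex_of_real (noise_family W \<xi> h (Inl (Suc (2 * n))) \<omega>))
      * (a + b * complex_of_real (noise_family W \<xi> h (Inl (2 * n)) \<omega>))"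
proof -
  have "real n * (2 * h) = real (2 * n) * h" "real (2 * n) * h + h = real (Suc (2 * n)) * h"
    by (simp_all add: algebra_simps)
  then show ?thesis unfolding fine_factor_def noise_family_def by (simp only: sum.case)
qed

text \<open>The coarse increment is the sum of the two fine ones; normalizing by \<open>sqrt (2 * h)\<close> in place of
\<open>sqrt h\<close> leaves the factor \<open>1 / sqrt 2\<close>.\<close>
lemma coarse_factor_noise:
  assumes h: "0 < h"
  shows "coarse_factor W (2 * h) A B n \<omega> = A + B / sqrt 2
    * complex_of_real (noise_family W \<xi> h (Inl (2 * n)) \<omega> + noise_family W \<xi> h (Inl (Suc (2 * n))) \<omega>)"
proof -
  let ?x = "noise_family W \<xi> h (Inl (2 * n)) \<omega> + noise_family W \<xi> h (Inl (Suc (2 * n))) \<omega>"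
  have grid: "real n * (2 * h) = real (2 * n) * h" "real (2 * n) * h + h = real (Suc (2 * n)) * h"
    "real (Suc (2 * n)) * h + h = real (2 * n) * h + 2 * h"
    by (simp_all add: algebra_simps)
  have "?x = (W (real n * (2 * h) + 2 * h) \<omega> - W (real n * (2 * h)) \<omega>) / sqrt h"
    unfolding noise_family_def normalized_incr_def sum.case grid
    by (simp add: add_divide_distrib[symmetric] del: of_nat_Suc of_nat_mult)
  then have "normalized_incr W (2 * h) (real n * (2 * h)) \<omega> = ?x / sqrt 2"
    using h by (simp add: normalized_incr_def real_sqrt_mult)
  then show ?thesis unfolding coarse_factor_def by simp
qed

section \<open>The error bound\<close>

theorem corollary3p1:
  fixes M :: "'w measure" and W :: "real \<Rightarrow> 'w \<Rightarrow> real"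
    and T \<Delta>T \<Delta>t \<theta>f \<theta>g :: real and N k :: nat
    and lam mu u0 a b A B :: complex
    and F G u :: "nat \<Rightarrow> 'w \<Rightarrow> complex"
    and U alph :: "nat \<Rightarrow> nat \<Rightarrow> 'w \<Rightarrow> complex"
    and \<alpha> \<beta> \<gamma> \<kappa> :: real
  assumes prob: "prob_space M"
    and wiener: "wiener_process M T W"
    and T_pos: "0 < T" and N_pos: "0 < N"
    and coarse_step: "\<Delta>T = T / real N" and fine_step: "\<Delta>t = \<Delta>T / 2"
    and theta_f: "\<theta>f \<in> {0..1}" and theta_g: "\<theta>g \<in> {0..1}"
    and denom_f: "1 - complex_of_real (\<theta>f * \<Delta>t) * lam \<noteq> 0"
    and denom_g: "1 - complex_of_real (\<theta>g * \<Delta>T) * lam \<noteq> 0"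
    and a: "a = theta_drift \<theta>f \<Delta>t lam" and b: "b = theta_diffusion \<theta>f \<Delta>t lam mu"
    and A: "A = theta_drift \<theta>g \<Delta>T lam" and B: "B = theta_diffusion \<theta>g \<Delta>T lam mu"
    and F: "F = fine_factor W \<Delta>T \<Delta>t a b" and G: "G = coarse_factor W \<Delta>T A B"
    and u0: "u0 \<noteq> 0"
    and fine: "fine_solution M N u0 F u"
    and scheme: "sparareal_scheme M N u0 F G U alph"
    and sampling: "sampling_rule1 M T W N F G U alph \<or> sampling_rule3 M T W N F G U alph"
    and Im_zero: "Im (A * (cnj a)\<^sup>2 + sqrt 2 * B * cnj (a * b)) = 0"
    and \<gamma>: "\<gamma> = (cmod A)\<^sup>2 + (cmod B)\<^sup>2"
    and \<kappa>: "\<kappa> = ((cmod a)\<^sup>2 + (cmod b)\<^sup>2)\<^sup>2"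
    and \<alpha>: "\<alpha> = (cmod A)\<^sup>2 + (cmod B)\<^sup>2
        + cmod (A * (cnj a)\<^sup>2 - (cmod B)\<^sup>2 - (cmod A)\<^sup>2 + sqrt 2 * B * cnj (a * b))"
    and \<beta>: "\<beta> = - 2 * Re (cnj A * a\<^sup>2) + (cmod A)\<^sup>2 + (cmod B)\<^sup>2
        - 2 * sqrt 2 * Re (cnj B * a * b) + ((cmod a)\<^sup>2 + (cmod b)\<^sup>2)\<^sup>2
        + cmod (A * (cnj a)\<^sup>2 - (cmod B)\<^sup>2 - (cmod A)\<^sup>2 + sqrt 2 * B * cnj (a * b))"
    and \<alpha>_less: "\<alpha> < 1"
  shows "sup_error M N u U k \<le> sup_error M N u U 0 *
    ((4 * \<beta> * \<gamma> / (1 - \<alpha>)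
      + sqrt ((4 * \<beta> * \<gamma> / (1 - \<alpha>))\<^sup>2 + 4 * ((2 * \<beta> * \<kappa> + 4 * \<beta> * \<gamma>) / (1 - \<alpha>)))) / 2) ^ k"
proof -
  interpret prob_space M by (rule prob)
  have steps: "0 < \<Delta>t" "\<Delta>T = 2 * \<Delta>t" "T = 2 * real N * \<Delta>t"
    using T_pos N_pos coarse_step fine_step by simp_all
  \<comment> \<open>Both sampling rules in one form: \<open>g\<close> is the identity for the normal rule and
    \<open>g x = sqrt 3 * (2 * x - 1)\<close> for the uniform one.\<close>
  obtain f \<xi> and g :: "real \<Rightarrow> real" where samples: "sampling_variables M T W N f \<xi>"
    and g [measurable]: "g \<in> borel_measurable borel"
    and square: "\<And>k n. 1 \<le> k \<Longrightarrow> n \<in> {1..<N} \<Longrightarrow> integrable M (\<lambda>\<omega>. (g (\<xi> k n \<omega>))\<^sup>2)"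
      "\<And>k n. 1 \<le> k \<Longrightarrow> n \<in> {1..<N} \<Longrightarrow> expectation (\<lambda>\<omega>. (g (\<xi> k n \<omega>))\<^sup>2) = 1"
    and rule: "\<And>k n \<omega>. 1 \<le> k \<Longrightarrow> n \<in> {1..<N} \<Longrightarrow> \<omega> \<in> space M \<Longrightarrow>
      alph k n \<omega> = F (n - 1) \<omega> * U (k - 1) (n - 1) \<omega>
        + complex_of_real (sparareal_sigma G U k n \<omega> * g (\<xi> k n \<omega>))"
    using sampling
  proof
    assume "sampling_rule1 M T W N F G U alph"
    then obtain z where z: "sampling_variables M T W N (\<lambda>x. ennreal (normal_density 0 1 x)) z"
      and rule: "\<forall>k\<ge>1. \<forall>n\<in>{1..<N}. \<forall>\<omega>\<in>space M.
           alph k n \<omega> = F (n - 1) \<omega> * U (k - 1) (n - 1) \<omega>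
             + complex_of_real (sparareal_sigma G U k n \<omega> * z k n \<omega>)"
      unfolding sampling_rule1_def by blast
    have "distributed M lborel (z k n) (normal_density 0 1)" if "1 \<le> k" "n \<in> {1..<N}" for k n
      using z that unfolding sampling_variables_def Let_def by auto
    note moments = centred_normal_moments(2,4)[OF zero_less_one this]
    show thesis
      by (rule that[of _ z "\<lambda>x. x"]) (use z rule moments in \<open>auto simp: power_one\<close>)
  next
    assume "sampling_rule3 M T W N F G U alph"
    then obtain w where w: "sampling_variables M T W N (\<lambda>x. indicator {0..1} x) w"
      and rule: "\<forall>k\<ge>1. \<forall>n\<in>{1..<N}. \<forall>\<omega>\<in>space M.
           alph k n \<omega> = F (n - 1) \<omega> * U (k - 1) (n - 1) \<omega>
             + complex_of_real (sqrt 3 * sparareal_sigma G U k n \<omega> * (2 * w k n \<omega> - 1))"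
      unfolding sampling_rule3_def by blast
    have "distributed M lborel (w k n) (\<lambda>x. indicator {0..1} x)" if "1 \<le> k" "n \<in> {1..<N}" for k n
      using w that unfolding sampling_variables_def Let_def by auto
    note moments = rescaled_uniform_square[OF this]
    have swap: "sqrt 3 * s * (2 * x - 1) = s * (sqrt 3 * (2 * x - 1))" for s x :: real
      by simp
    show thesis
    proof (rule that[of _ w "\<lambda>x. sqrt 3 * (2 * x - 1)"])
      show "sampling_variables M T W N (\<lambda>x. indicator {0..1} x) w" by (rule w)
      show "(\<lambda>x::real. sqrt 3 * (2 * x - 1)) \<in> borel_measurable borel" by measurable
    qed (use rule moments in \<open>simp_all only: swap\<close>)
  qed
  let ?X = "noise_family W \<xi> \<Delta>t"
  interpret independent_family M ?X "noise_index N"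
    by (rule independent_family_noise[OF wiener steps(1,3) samples])
  have std: "standardized (Inl i)" if "i < 2 * N" for i
  proof -
    have "0 \<le> real i * \<Delta>t" "real i * \<Delta>t + \<Delta>t \<le> T"
      using grid_point[OF steps(1,3), of i] grid_point[OF steps(1,3), of "Suc i"] that
      by (simp_all add: algebra_simps)
    from normalized_increment_moments[OF wiener steps(1) this] show ?thesis
      unfolding standardized_def using that by (auto simp: noise_family_def noise_index_def)
  qed
  interpret sparareal M N ?X a b A B u0 F G u U alph "\<lambda>k n \<omega>. g (\<xi> k n \<omega>)" \<alpha> \<beta> \<gamma> \<kappa>
  proof
    show "F n = (\<lambda>\<omega>. (a + b * complex_of_real (?X (Inl (Suc (2 * n))) \<omega>))
        * (a + b * complex_of_real (?X (Inl (2 * n)) \<omega>)))" for n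
      unfolding F steps(2) by (rule ext) (rule fine_factor_noise)
    show "G n = (\<lambda>\<omega>. A + B / sqrt 2
        * complex_of_real (?X (Inl (2 * n)) \<omega> + ?X (Inl (Suc (2 * n))) \<omega>))" for n
      unfolding G steps(2) by (rule ext) (rule coarse_factor_noise[OF steps(1)])
    show "(\<lambda>\<omega>. g (\<xi> k n \<omega>)) \<in> borel_measurable (info {Inr (k, n)})" for k n
    proof -
      have "?X (Inr (k, n)) \<in> borel_measurable (info {Inr (k, n)})"
        by (rule measurable_info_component) simp
      then have "\<xi> k n \<in> borel_measurable (info {Inr (k, n)})"
        by (simp add: noise_family_def)
      then show ?thesis by measurable
    qed
  qed (fact std fine scheme square rule \<gamma> \<kappa> \<alpha> \<beta>)+
  show ?thesis by (rule sup_error_bound[OF N_pos \<alpha>_less])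
qed

end
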